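(* Let $G=\mathbb{Z}*\mathbb{Z}_2=\langle a,b : b^2=e\rangle$, let $c=bab\in G$, and let $\mathbb{F}_2=\langle a,c\rangle\subset G$, which is a copy of the free group on two generators. Then the restriction map $R:Sof(G,P^\omega)\to Sof(\mathbb{F}_2,P^\omega)$, $R([\Theta])=[\Theta|_{\mathbb{F}_2}]$, is not surjective.
   Context: $\omega$ is a free ultrafilter on $\mathbb{N}$. $P_n\subset M_n(\mathbb{C})$ is the group of permutation matrices, identified with $Sym(n)$, with normalised Hamming distance $d_H(p,q)=\frac1n|\{i:p(i)\neq q(i)\}|=1-Tr(pq^* )$, where $Tr$ is the normalised trace. For a sequence $(n_k)_k$ of natural numbers, $\Pi_{k\to\omega}P_{n_k}$ is the metric ultraproduct, i.e. the quotient of $\prod_kP_{n_k}$ by the normal subgroup of sequences $(p_k)$ with $\lim_{k\to\omega}d_H(p_k,1)=0$; it carries the trace $Tr(\Pi_{k\to\omega}p_k)=\lim_{k\to\omega}Tr(p_k)$. A sofic representation of a countable group $H$ is a group homomorphism $\Theta:H\to\Pi_{k\to\omega}P_{n_k}$, for some sequence $n_k\to\infty$, such that $Tr(\Theta(g))=0$ for all $g\neq e$. For a sequence $(r_k)_k$ of positive integers, the amplification $\Theta\otimes 1_{r_k}:H\to\Pi_{k\to\omega}P_{n_kr_k}$ is the composition of $\Theta$ with $\Pi_{k\to\omega}p_k\mapsto\Pi_{k\to\omega}(p_k\otimes 1_{r_k})$. Two sofic representations of $H$ (possibly over different sequences of dimensions) are equivalent if they have amplifications, over a common sequence of dimensions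 $(m_k)_k$, that are conjugate by an element of $\Pi_{k\to\omega}P_{m_k}$. $Sof(H,P^\omega)$ is the set of equivalence classes $[\Theta]$ of sofic representations of $H$. *)

theory Defs
  imports Complex_Main "HOL-Algebra.Sym_Groups" "HOL-Algebra.Product_Groups"
begin

section \<open>Group presentations\<close>

text \<open>A word is a list of signed letters; \<open>(x, True)\<close> is the formal inverse of \<open>(x, False)\<close>.\<close>

type_synonym 'g word = "('g \<times> bool) list"

inductive word_cong :: "'g word set \<Rightarrow> 'g word \<Rightarrow> 'g word \<Rightarrow> bool" for R where
  refl: "word_cong R u u"
| sym: "word_cong R u v \<Longrightarrow> word_cong R v u"
| trans: "word_cong R u v \<Longrightarrow> word_cong R v w \<Longrightarrow> word_cong R u w"
| append: "word_cong R u u' \<Longrightarrow> word_cong R v v' \<Longrightarrow> word_cong R (u @ v) (u' @ v')"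
| cancel: "word_cong R [(x, e), (x, \<not> e)] []"
| relator: "r \<in> R \<Longrightarrow> word_cong R r []"

definition word_class :: "'g word set \<Rightarrow> 'g word \<Rightarrow> 'g word set" where
  "word_class R u = {v. word_cong R u v}"

text \<open>The group generated by all elements of the type \<open>'g\<close> subject to the relators \<open>R\<close>.\<close>

definition presented_group :: "'g word set \<Rightarrow> 'g word set monoid" where
  "presented_group R =
     \<lparr>carrier = range (word_class R),
      mult = (\<lambda>X Y. \<Union>u\<in>X. \<Union>v\<in>Y. word_class R (u @ v)),
      one = word_class R []\<rparr>"

datatype gen = Gen_A | Gen_B

definition Z_free_Z2 :: "gen word set monoid" where
  "Z_free_Z2 = presented_group {[(Gen_B, False), (Gen_B, False)]}"

definition gen_a :: "gen word set" where
  "gen_a = word_class {[(Gen_B, False), (Gen_B, False)]} [(Gen_A, False)]"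

definition gen_b :: "gen word set" where
  "gen_b = word_class {[(Gen_B, False), (Gen_B, False)]} [(Gen_B, False)]"

definition gen_c :: "gen word set" where
  "gen_c = gen_b \<otimes>\<^bsub>Z_free_Z2\<^esub> gen_a \<otimes>\<^bsub>Z_free_Z2\<^esub> gen_b"

definition F2 :: "gen word set monoid" where
  "F2 = subgroup_generated Z_free_Z2 {gen_a, gen_c}"


section \<open>Metric ultraproducts of symmetric groups\<close>

definition free_ultrafilter :: "'a filter \<Rightarrow> bool" where
  "free_ultrafilter F \<longleftrightarrow>
     F \<noteq> bot \<and>
     (\<forall>P. eventually P F \<or> eventually (\<lambda>x. \<not> P x) F) \<and>
     (\<forall>P. eventually P F \<longrightarrow> infinite {x. P x})"

definition hamming_dist :: "nat \<Rightarrow> (nat \<Rightarrow> nat) \<Rightarrow> (nat \<Rightarrow> nat) \<Rightarrow> real" where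
  "hamming_dist n p q = card {i \<in> {1..n}. p i \<noteq> q i} / n"

text \<open>The normalised trace of the permutation matrix of \<open>p\<close>: its diagonal has an entry 1 at each
  fixed point and 0 elsewhere.\<close>

definition perm_trace :: "nat \<Rightarrow> (nat \<Rightarrow> nat) \<Rightarrow> real" where
  "perm_trace n p = card {i \<in> {1..n}. p i = i} / n"

abbreviation perm_seqs :: "(nat \<Rightarrow> nat) \<Rightarrow> (nat \<Rightarrow> nat \<Rightarrow> nat) monoid" where
  "perm_seqs n \<equiv> product_group UNIV (\<lambda>k. sym_group (n k))"

definition null_seqs :: "nat filter \<Rightarrow> (nat \<Rightarrow> nat) \<Rightarrow> (nat \<Rightarrow> nat \<Rightarrow> nat) set" where
  "null_seqs \<omega> n =
     {p \<in> carrier (perm_seqs n). ((\<lambda>k. hamming_dist (n k) (p k) id) \<longlongrightarrow> 0) \<omega>}"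

definition ultraprod :: "nat filter \<Rightarrow> (nat \<Rightarrow> nat) \<Rightarrow> (nat \<Rightarrow> nat \<Rightarrow> nat) set monoid" where
  "ultraprod \<omega> n = perm_seqs n Mod null_seqs \<omega> n"

definition ultra_trace :: "nat filter \<Rightarrow> (nat \<Rightarrow> nat) \<Rightarrow> (nat \<Rightarrow> nat \<Rightarrow> nat) set \<Rightarrow> real" where
  "ultra_trace \<omega> n X = (THE t. \<forall>p\<in>X. ((\<lambda>k. perm_trace (n k) (p k)) \<longlongrightarrow> t) \<omega>)"

text \<open>The permutation of \<open>{1..n * r}\<close> given by the Kronecker product of the permutation matrix
  of \<open>p\<close> with the identity matrix of size \<open>r\<close>: the pair \<open>(i, j)\<close> in \<open>{1..n} \<times> {0..<r}\<close> is encoded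
  as \<open>(i - 1) * r + j + 1\<close>.\<close>

definition amplify_perm :: "nat \<Rightarrow> (nat \<Rightarrow> nat) \<Rightarrow> nat \<Rightarrow> nat" where
  "amplify_perm r p i =
     (case i of 0 \<Rightarrow> 0 | Suc j \<Rightarrow> Suc ((p (Suc (j div r)) - 1) * r + j mod r))"

definition amplify ::
    "nat filter \<Rightarrow> (nat \<Rightarrow> nat) \<Rightarrow> (nat \<Rightarrow> nat) \<Rightarrow> (nat \<Rightarrow> nat \<Rightarrow> nat) set \<Rightarrow> (nat \<Rightarrow> nat \<Rightarrow> nat) set" where
  "amplify \<omega> n r X =
     (\<Union>p\<in>X. null_seqs \<omega> (\<lambda>k. n k * r k) #>\<^bsub>perm_seqs (\<lambda>k. n k * r k)\<^esub>
               (\<lambda>k. amplify_perm (r k) (p k)))"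


section \<open>Sofic representations\<close>

text \<open>A representation is paired with its sequence of dimensions, and is \<open>undefined\<close> outside the
  carrier of the group.\<close>

type_synonym 'g rep = "(nat \<Rightarrow> nat) \<times> ('g \<Rightarrow> (nat \<Rightarrow> nat \<Rightarrow> nat) set)"

definition sofic_reps :: "nat filter \<Rightarrow> ('g, 'm) monoid_scheme \<Rightarrow> 'g rep set" where
  "sofic_reps \<omega> H =
     {(n, \<Theta>). (\<forall>k. n k > 0) \<and> filterlim n at_top sequentially \<and>
        \<Theta> \<in> hom H (ultraprod \<omega> n) \<and> \<Theta> \<in> extensional (carrier H) \<and>
        (\<forall>g\<in>carrier H. g \<noteq> \<one>\<^bsub>H\<^esub> \<longrightarrow> ultra_trace \<omega> n (\<Theta> g) = 0)}"

definition amplify_rep ::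
    "nat filter \<Rightarrow> ('g, 'm) monoid_scheme \<Rightarrow> (nat \<Rightarrow> nat) \<Rightarrow> 'g rep \<Rightarrow> 'g rep" where
  "amplify_rep \<omega> H r = (\<lambda>(n, \<Theta>). (\<lambda>k. n k * r k, \<lambda>g\<in>carrier H. amplify \<omega> n r (\<Theta> g)))"

definition conjugate_reps ::
    "nat filter \<Rightarrow> ('g, 'm) monoid_scheme \<Rightarrow> 'g rep \<Rightarrow> 'g rep \<Rightarrow> bool" where
  "conjugate_reps \<omega> H = (\<lambda>(m, \<Theta>) (m', \<Phi>). m = m' \<and>
     (\<exists>u\<in>carrier (ultraprod \<omega> m). \<forall>g\<in>carrier H.
        \<Phi> g = u \<otimes>\<^bsub>ultraprod \<omega> m\<^esub> \<Theta> g \<otimes>\<^bsub>ultraprod \<omega> m\<^esub> inv\<^bsub>ultraprod \<omega> m\<^esub> u))"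

definition sofic_equiv :: "nat filter \<Rightarrow> ('g, 'm) monoid_scheme \<Rightarrow> 'g rep rel" where
  "sofic_equiv \<omega> H =
     {(x, y). x \<in> sofic_reps \<omega> H \<and> y \<in> sofic_reps \<omega> H \<and>
        (\<exists>r s. (\<forall>k. r k > 0 \<and> s k > 0) \<and>
           conjugate_reps \<omega> H (amplify_rep \<omega> H r x) (amplify_rep \<omega> H s y))}"

definition Sof :: "nat filter \<Rightarrow> ('g, 'm) monoid_scheme \<Rightarrow> 'g rep set set" where
  "Sof \<omega> H = sofic_reps \<omega> H // sofic_equiv \<omega> H"

definition restrict_rep :: "('g, 'm) monoid_scheme \<Rightarrow> 'g rep \<Rightarrow> 'g rep" where
  "restrict_rep K = (\<lambda>(n, \<Theta>). (n, restrict \<Theta> (carrier K)))"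

text \<open>The map induced by \<open>restrict_rep\<close> on equivalence classes; see \<open>restriction_map_class\<close>.\<close>

definition restriction_map ::
    "nat filter \<Rightarrow> ('g, 'm) monoid_scheme \<Rightarrow> 'g rep set \<Rightarrow> 'g rep set" where
  "restriction_map \<omega> K C = (\<Union>x\<in>C. sofic_equiv \<omega> K `` {restrict_rep K x})"


section \<open>Well-definedness\<close>

subsection \<open>Presented groups\<close>

lemma word_class_eq_iff: "word_class R u = word_class R v \<longleftrightarrow> word_cong R u v"
  unfolding word_class_def set_eq_iff mem_Collect_eq
  by (meson word_cong.refl word_cong.sym word_cong.trans)

lemma mem_word_class: "v \<in> word_class R u \<longleftrightarrow> word_cong R u v"
  by (simp add: word_class_def)

lemma presented_group_mult [simp]:
  "word_class R u \<otimes>\<^bsub>presented_group R\<^esub> word_class R v = word_class R (u @ v)"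
proof -
  have eq: "word_class R (u' @ v') = word_class R (u @ v)"
    if "u' \<in> word_class R u" "v' \<in> word_class R v" for u' v'
    using that unfolding word_class_eq_iff mem_word_class
    by (intro word_cong.append word_cong.sym[of R u] word_cong.sym[of R v])
  have "u \<in> word_class R u" "v \<in> word_class R v"
    by (simp_all add: mem_word_class word_cong.refl)
  then have "(\<Union>u'\<in>word_class R u. \<Union>v'\<in>word_class R v. word_class R (u' @ v')) = word_class R (u @ v)"
    using eq by blast
  then show ?thesis
    by (simp add: presented_group_def)
qed

lemma presented_group_one: "\<one>\<^bsub>presented_group R\<^esub> = word_class R []"
  by (simp add: presented_group_def)

lemma presented_group_carrier: "carrier (presented_group R) = range (word_class R)"
  by (simp add: presented_group_def)

lemma word_inverse: "\<exists>v. word_cong R (v @ u) []"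
proof (induction u)
  case Nil
  show ?case by (metis append_Nil word_cong.refl)
next
  case (Cons l u)
  then obtain v where v: "word_cong R (v @ u) []" by blast
  obtain x e where l: "l = (x, e)" by force
  have "word_cong R [(x, \<not> e), (x, e)] []"
    using word_cong.cancel[of R x "\<not> e"] by simp
  then have "word_cong R (v @ [(x, \<not> e), (x, e)] @ u) (v @ [] @ u)"
    by (intro word_cong.append word_cong.refl)
  then have "word_cong R ((v @ [(x, \<not> e)]) @ l # u) []"
    using v l by (auto intro: word_cong.trans)
  then show ?case by blast
qed

lemma presented_group_is_group: "group (presented_group R)"
proof (rule groupI)
  fix X assume "X \<in> carrier (presented_group R)"
  then obtain u where u: "X = word_class R u"
    by (auto simp: presented_group_carrier)
  obtain v where "word_cong R (v @ u) []"
    using word_inverse by blast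
  then have "word_class R v \<otimes>\<^bsub>presented_group R\<^esub> X = \<one>\<^bsub>presented_group R\<^esub>"
    by (simp add: u presented_group_one word_class_eq_iff)
  then show "\<exists>Y\<in>carrier (presented_group R). Y \<otimes>\<^bsub>presented_group R\<^esub> X = \<one>\<^bsub>presented_group R\<^esub>"
    by (auto simp: presented_group_carrier)
qed (auto simp: presented_group_carrier presented_group_one)

lemma Z_free_Z2_is_group: "group Z_free_Z2"
  by (simp add: Z_free_Z2_def presented_group_is_group)

lemma gens_in_Z_free_Z2: "gen_a \<in> carrier Z_free_Z2" "gen_b \<in> carrier Z_free_Z2" "gen_c \<in> carrier Z_free_Z2"
proof -
  show a: "gen_a \<in> carrier Z_free_Z2" and b: "gen_b \<in> carrier Z_free_Z2"
    by (auto simp: gen_a_def gen_b_def Z_free_Z2_def presented_group_carrier)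
  show "gen_c \<in> carrier Z_free_Z2"
    unfolding gen_c_def
    using a b monoid.m_closed[OF group.is_monoid[OF Z_free_Z2_is_group]] by blast
qed


subsection \<open>The subgroup generated by \<open>a\<close> and \<open>c\<close> is free\<close>

abbreviation RB :: "gen word set" where
  "RB \<equiv> {[(Gen_B, False), (Gen_B, False)]}"

text \<open>Reading a word in \<open>a, b\<close> from the left with a flag that every occurrence of \<open>b\<close> flips,
  letters \<open>a\<close> are translated to the first or the second free generator according to the flag.\<close>

fun unfold_word :: "bool \<Rightarrow> gen word \<Rightarrow> gen word" where
  "unfold_word s [] = []"
| "unfold_word s ((Gen_A, e) # u) = ((if s then Gen_B else Gen_A), e) # unfold_word s u"
| "unfold_word s ((Gen_B, e) # u) = unfold_word (\<not> s) u"

fun flag :: "bool \<Rightarrow> gen word \<Rightarrow> bool" where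
  "flag s [] = s"
| "flag s ((Gen_A, e) # u) = flag s u"
| "flag s ((Gen_B, e) # u) = flag (\<not> s) u"

lemma unfold_word_append: "unfold_word s (u @ v) = unfold_word s u @ unfold_word (flag s u) v"
  by (induction s u rule: unfold_word.induct) auto

lemma flag_append: "flag s (u @ v) = flag (flag s u) v"
  by (induction s u rule: flag.induct) auto

lemma unfold_word_cong:
  "word_cong RB u v \<Longrightarrow> (\<forall>s. flag s u = flag s v \<and> word_cong {} (unfold_word s u) (unfold_word s v))"
proof (induction rule: word_cong.induct)
  case (cancel x e)
  then show ?case by (cases x) (auto intro: word_cong.cancel word_cong.refl)
qed (auto simp: unfold_word_append flag_append
       intro: word_cong.refl word_cong.sym word_cong.trans word_cong.append)

fun fold_word :: "gen word \<Rightarrow> gen word" where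
  "fold_word [] = []"
| "fold_word ((Gen_A, e) # u) = (Gen_A, e) # fold_word u"
| "fold_word ((Gen_B, e) # u) = [(Gen_B, False), (Gen_A, e), (Gen_B, False)] @ fold_word u"

lemma fold_word_append: "fold_word (u @ v) = fold_word u @ fold_word v"
  by (induction u rule: fold_word.induct) auto

lemma unfold_fold_word: "unfold_word False (fold_word u) = u"
  by (induction u rule: fold_word.induct) auto

lemma word_cong_BB: "word_cong RB (u @ [(Gen_B, False), (Gen_B, False)] @ v) (u @ v)"
  using word_cong.append[OF word_cong.refl[of RB u]
      word_cong.append[OF word_cong.relator[of _ RB] word_cong.refl[of RB v]]]
  by simp

lemma fold_word_cong: "word_cong {} u v \<Longrightarrow> word_cong RB (fold_word u) (fold_word v)"
proof (induction rule: word_cong.induct)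
  case (cancel x e)
  show ?case
  proof (cases x)
    case Gen_B
    have "word_cong RB ([(Gen_B, False), (Gen_A, e)] @ [(Gen_B, False), (Gen_B, False)] @ [(Gen_A, \<not> e), (Gen_B, False)])
        ([(Gen_B, False), (Gen_A, e)] @ [(Gen_A, \<not> e), (Gen_B, False)])"
      by (rule word_cong_BB)
    moreover have "word_cong RB ([(Gen_B, False)] @ [(Gen_A, e), (Gen_A, \<not> e)] @ [(Gen_B, False)])
        ([(Gen_B, False)] @ [] @ [(Gen_B, False)])"
      by (intro word_cong.append word_cong.refl word_cong.cancel)
    moreover have "word_cong RB [(Gen_B, False), (Gen_B, False)] []"
      by (rule word_cong.relator) simp
    ultimately show ?thesis
      using Gen_B by (auto intro: word_cong.trans)
  qed (auto intro: word_cong.cancel)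
qed (auto simp: fold_word_append
       intro: word_cong.refl word_cong.sym word_cong.trans word_cong.append)

theorem F2_is_free: "F2 \<cong> presented_group ({} :: gen word set)"
proof -
  let ?F = "presented_group ({} :: gen word set)"
  interpret G: group Z_free_Z2 by (rule Z_free_Z2_is_group)
  interpret F: group ?F by (rule presented_group_is_group)
  define f where "f X = word_class RB (fold_word (SOME u. u \<in> X))" for X
  have f: "f (word_class {} u) = word_class RB (fold_word u)" for u
  proof -
    have "word_cong {} u (SOME v. v \<in> word_class {} u)"
      by (metis mem_word_class someI word_cong.refl)
    then show ?thesis
      using fold_word_cong by (auto simp: f_def word_class_eq_iff intro: word_cong.sym)
  qed
  have hom: "f \<in> hom ?F Z_free_Z2"
    by (rule homI) (auto simp: presented_group_carrier Z_free_Z2_def f fold_word_append)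
  have gc: "gen_c = word_class RB [(Gen_B, False), (Gen_A, False), (Gen_B, False)]"
    by (simp add: gen_c_def gen_a_def gen_b_def Z_free_Z2_def)
  have inj: "inj_on f (carrier ?F)"
  proof (rule inj_onI, clarsimp simp: presented_group_carrier f word_class_eq_iff)
    fix u v :: "gen word" assume "word_cong RB (fold_word u) (fold_word v)"
    from unfold_word_cong[OF this] show "word_cong {} u v"
      by (metis unfold_fold_word)
  qed
  interpret f: group_hom ?F Z_free_Z2 f
    using hom by unfold_locales
  have fa: "f (word_class {} [(Gen_A, False)]) = gen_a" and fb: "f (word_class {} [(Gen_B, False)]) = gen_c"
    by (simp_all add: f gen_a_def gc)
  have inv: "inv\<^bsub>?F\<^esub> (word_class {} [(x, False)]) = word_class {} [(x, True)]" for x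
  proof (rule F.inv_equality)
    show "word_class {} [(x, True)] \<otimes>\<^bsub>?F\<^esub> word_class {} [(x, False)] = \<one>\<^bsub>?F\<^esub>"
      using word_cong.cancel[of "{}" x True]
      by (simp add: presented_group_one word_class_eq_iff)
  qed (auto simp: presented_group_carrier)
  have sub: "subgroup (generate Z_free_Z2 {gen_a, gen_c}) Z_free_Z2"
    using gens_in_Z_free_Z2 by (intro G.generate_is_subgroup) auto
  have car: "carrier F2 = generate Z_free_Z2 {gen_a, gen_c}"
    using gens_in_Z_free_Z2 by (simp add: F2_def carrier_subgroup_generated Int_absorb1)
  have letter: "f (word_class {} [(x, e)]) \<in> generate Z_free_Z2 {gen_a, gen_c}" for x e
  proof -
    have g: "f (word_class {} [(x, False)]) \<in> generate Z_free_Z2 {gen_a, gen_c}" for x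
      by (cases x) (auto simp: fa fb intro: generate.incl)
    have "f (word_class {} [(x, True)]) = inv\<^bsub>Z_free_Z2\<^esub> (f (word_class {} [(x, False)]))"
      using f.hom_inv[of "word_class {} [(x, False)]"] by (simp add: inv presented_group_carrier)
    then show ?thesis
      using g subgroup.m_inv_closed[OF sub g[of x]] by (cases e) auto
  qed
  have into: "f (word_class {} u) \<in> generate Z_free_Z2 {gen_a, gen_c}" for u
  proof (induction u)
    case Nil
    show ?case
      using f.hom_one subgroup.one_closed[OF sub] by (simp add: presented_group_one)
  next
    case (Cons l u)
    obtain x e where l: "l = (x, e)" by force
    have "f (word_class {} (l # u)) =
        f (word_class {} [(x, e)]) \<otimes>\<^bsub>Z_free_Z2\<^esub> f (word_class {} u)"
      using f.hom_mult[of "word_class {} [(x, e)]" "word_class {} u"]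
      by (simp add: l presented_group_carrier)
    then show ?case
      using letter Cons subgroup.m_closed[OF sub] by simp
  qed
  have img: "f ` carrier ?F = carrier F2"
  proof
    show "f ` carrier ?F \<subseteq> carrier F2"
      using into by (auto simp: presented_group_carrier car)
    have "subgroup (f ` carrier ?F) Z_free_Z2"
      by (rule f.img_is_subgroup)
    moreover have "{gen_a, gen_c} \<subseteq> f ` carrier ?F"
      using fa fb by (force simp: presented_group_carrier)
    ultimately show "carrier F2 \<subseteq> f ` carrier ?F"
      unfolding car by (rule G.generate_subgroup_incl[rotated])
  qed
  have "f \<in> iso ?F F2"
    using hom inj img by (auto simp: iso_def bij_betw_def hom_def F2_def)
  then show ?thesis
    by (meson F.iso_sym is_isoI)
qed


subsection \<open>The ultraproduct is a group\<close>

lemma hamming_dist_nonneg: "hamming_dist n p q \<ge> 0"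
  by (simp add: hamming_dist_def)

lemma hamming_dist_comp:
  assumes "q permutes {1..n}"
  shows "hamming_dist n (p \<circ> q) id \<le> hamming_dist n p id + hamming_dist n q id"
proof -
  have "card {i \<in> {1..n}. (p \<circ> q) i \<noteq> id i}
      \<le> card ({i \<in> {1..n}. p i \<noteq> id i} \<union> {i \<in> {1..n}. q i \<noteq> id i})"
    by (rule card_mono) auto
  also have "\<dots> \<le> card {i \<in> {1..n}. p i \<noteq> id i} + card {i \<in> {1..n}. q i \<noteq> id i}"
    by (rule card_Un_le)
  finally show ?thesis
    unfolding hamming_dist_def add_divide_distrib[symmetric]
    by (intro divide_right_mono) (simp_all only: of_nat_add[symmetric] of_nat_le_iff of_nat_0_le_iff)
qed

lemma hamming_dist_inv:
  assumes "p permutes {1..n}"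
  shows "hamming_dist n (inv' p) id = hamming_dist n p id"
proof -
  have "inv' p i = i \<longleftrightarrow> p i = i" for i
    using permutes_inverses[OF assms] by metis
  then show ?thesis by (simp add: hamming_dist_def)
qed

lemma hamming_dist_conj:
  assumes "p permutes {1..n}" "u permutes {1..n}"
  shows "hamming_dist n (u \<circ> p \<circ> inv' u) id = hamming_dist n p id"
proof -
  have "bij_betw u {i \<in> {1..n}. p i \<noteq> id i} {i \<in> {1..n}. (u \<circ> p \<circ> inv' u) i \<noteq> id i}"
    unfolding bij_betw_def
  proof
    show "inj_on u {i \<in> {1..n}. p i \<noteq> id i}"
      using permutes_inj[OF assms(2)] by (auto simp: inj_on_def)
    show "u ` {i \<in> {1..n}. p i \<noteq> id i} = {i \<in> {1..n}. (u \<circ> p \<circ> inv' u) i \<noteq> id i}" (is "?L = ?R")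
    proof (rule Set.set_eqI)
      fix j
      have "j \<in> ?L \<longleftrightarrow> inv' u j \<in> {i \<in> {1..n}. p i \<noteq> id i}"
        using permutes_inverses[OF assms(2)] by (metis (no_types, lifting) image_iff)
      also have "\<dots> \<longleftrightarrow> j \<in> ?R"
        using permutes_inverses[OF assms(2)] permutes_in_image[OF permutes_inv[OF assms(2)], of j]
        by (simp, metis)
      finally show "j \<in> ?L \<longleftrightarrow> j \<in> ?R" .
    qed
  qed
  then show ?thesis
    by (simp only: hamming_dist_def bij_betw_same_card)
qed

lemma perm_seqs_group: "group (perm_seqs n)"
  by (simp add: sym_group_is_group)

lemma perm_seqs_carrier: "p \<in> carrier (perm_seqs n) \<longleftrightarrow> (\<forall>k. p k permutes {1..n k})"
  by (auto simp: sym_group_def PiE_UNIV_domain)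

lemma perm_seqs_mult: "p \<otimes>\<^bsub>perm_seqs n\<^esub> q = (\<lambda>k. p k \<circ> q k)"
  by (simp add: sym_group_def restrict_UNIV)

lemma perm_seqs_one: "\<one>\<^bsub>perm_seqs n\<^esub> = (\<lambda>k. id)"
  by (simp add: sym_group_def restrict_UNIV)

lemma perm_seqs_inv:
  assumes "p \<in> carrier (perm_seqs n)" shows "inv\<^bsub>perm_seqs n\<^esub> p = (\<lambda>k. inv' (p k))"
proof -
  have "p k \<in> carrier (sym_group (n k))" for k
    using assms by (auto simp: perm_seqs_carrier sym_group_carrier)
  then show ?thesis
    using assms by (simp add: inv_product_group sym_group_is_group fun_eq_iff)
qed

lemma null_seqs_normal: "null_seqs \<omega> n \<lhd> perm_seqs n"
proof -
  interpret P: group "perm_seqs n" by (rule perm_seqs_group)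
  have "subgroup (null_seqs \<omega> n) (perm_seqs n)"
  proof (rule P.subgroupI)
    show "null_seqs \<omega> n \<subseteq> carrier (perm_seqs n)"
      by (auto simp: null_seqs_def)
    have "(\<lambda>k. id) \<in> null_seqs \<omega> n"
      by (simp add: null_seqs_def perm_seqs_carrier permutes_id hamming_dist_def
          del: carrier_product_group)
    then show "null_seqs \<omega> n \<noteq> {}" by blast
    fix p assume p: "p \<in> null_seqs \<omega> n"
    then have pc: "p \<in> carrier (perm_seqs n)" by (simp add: null_seqs_def)
    show "inv\<^bsub>perm_seqs n\<^esub> p \<in> null_seqs \<omega> n"
      using p P.inv_closed[OF pc] pc hamming_dist_inv
      by (simp add: null_seqs_def perm_seqs_inv perm_seqs_carrier del: carrier_product_group)
    fix q assume q: "q \<in> null_seqs \<omega> n"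
    then have qc: "q \<in> carrier (perm_seqs n)" by (simp add: null_seqs_def)
    have "((\<lambda>k. hamming_dist (n k) (p k \<circ> q k) id) \<longlongrightarrow> 0) \<omega>"
    proof (rule tendsto_sandwich[of "\<lambda>_. 0"])
      show "((\<lambda>k. hamming_dist (n k) (p k) id + hamming_dist (n k) (q k) id) \<longlongrightarrow> 0) \<omega>"
        using p q by (auto simp: null_seqs_def intro: tendsto_add_zero)
      show "\<forall>\<^sub>F k in \<omega>. hamming_dist (n k) (p k \<circ> q k) id
          \<le> hamming_dist (n k) (p k) id + hamming_dist (n k) (q k) id"
        using qc hamming_dist_comp by (auto simp: perm_seqs_carrier simp del: carrier_product_group)
    qed (auto simp: hamming_dist_nonneg)
    then show "p \<otimes>\<^bsub>perm_seqs n\<^esub> q \<in> null_seqs \<omega> n"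
      using P.m_closed[OF pc qc] unfolding null_seqs_def perm_seqs_mult by simp
  qed
  moreover have "u \<otimes>\<^bsub>perm_seqs n\<^esub> p \<otimes>\<^bsub>perm_seqs n\<^esub> inv\<^bsub>perm_seqs n\<^esub> u \<in> null_seqs \<omega> n"
    if u: "u \<in> carrier (perm_seqs n)" and p: "p \<in> null_seqs \<omega> n" for u p
  proof -
    have pc: "p \<in> carrier (perm_seqs n)" using p by (simp add: null_seqs_def)
    have "u \<otimes>\<^bsub>perm_seqs n\<^esub> p \<otimes>\<^bsub>perm_seqs n\<^esub> inv\<^bsub>perm_seqs n\<^esub> u \<in> carrier (perm_seqs n)"
      by (intro P.m_closed P.inv_closed u pc)
    moreover have "u \<otimes>\<^bsub>perm_seqs n\<^esub> p \<otimes>\<^bsub>perm_seqs n\<^esub> inv\<^bsub>perm_seqs n\<^esub> u = (\<lambda>k. u k \<circ> p k \<circ> inv' (u k))"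
      by (simp only: perm_seqs_inv[OF u] perm_seqs_mult)
    moreover have "hamming_dist (n k) (u k \<circ> p k \<circ> inv' (u k)) id = hamming_dist (n k) (p k) id" for k
      using u pc unfolding perm_seqs_carrier by (intro hamming_dist_conj) auto
    ultimately show ?thesis
      using p by (simp add: null_seqs_def del: carrier_product_group mult_product_group)
  qed
  ultimately show ?thesis
    by (simp add: P.normal_inv_iff del: carrier_product_group mult_product_group inv_product_group)
qed

lemma ultraprod_group: "group (ultraprod \<omega> n)"
  unfolding ultraprod_def by (rule normal.factorgroup_is_group[OF null_seqs_normal])


subsection \<open>The trace on the ultraproduct\<close>

lemma tendsto_free_ultrafilter:
  fixes f :: "'a \<Rightarrow> real"
  assumes \<omega>: "free_ultrafilter \<omega>" and f: "\<And>x. f x \<in> {0..1}"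
  shows "\<exists>t. (f \<longlongrightarrow> t) \<omega>"
proof -
  have ultra: "eventually P \<omega> \<or> eventually (\<lambda>x. \<not> P x) \<omega>" for P
    using \<omega> by (simp add: free_ultrafilter_def)
  define S where "S = {s. \<forall>\<^sub>F x in \<omega>. s \<le> f x}"
  have S0: "0 \<in> S" using f by (auto simp: S_def)
  have bdd: "s \<le> 1" if "s \<in> S" for s
  proof (rule ccontr)
    assume "\<not> s \<le> 1"
    moreover have "f x \<le> 1" for x using f by simp
    ultimately have "\<not> s \<le> f x" for x by (meson order_trans)
    then have "\<forall>\<^sub>F x in \<omega>. False" using that by (simp add: S_def)
    then show False using \<omega> by (simp add: free_ultrafilter_def eventually_False)
  qed
  then have "bdd_above S" by (rule bdd_aboveI)
  have "(f \<longlongrightarrow> Sup S) \<omega>"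
  proof (rule order_tendstoI)
    fix a assume "a < Sup S"
    then obtain s where "s \<in> S" "a < s" using S0 less_cSupE[of a S] by blast
    then show "\<forall>\<^sub>F x in \<omega>. a < f x"
      unfolding S_def by (auto elim: eventually_mono)
  next
    fix a assume a: "Sup S < a"
    have "a \<notin> S" using a \<open>bdd_above S\<close> cSup_upper by (metis not_le)
    then show "\<forall>\<^sub>F x in \<omega>. f x < a"
      using ultra[of "\<lambda>x. a \<le> f x"] by (simp add: S_def not_le)
  qed
  then show ?thesis ..
qed

lemma perm_trace_dist:
  assumes "q permutes {1..n}"
  shows "\<bar>perm_trace n (p \<circ> q) - perm_trace n q\<bar> \<le> hamming_dist n p id"
proof -
  let ?D = "{i \<in> {1..n}. p i \<noteq> id i}"
  let ?D' = "{i \<in> {1..n}. p (q i) \<noteq> q i}"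
  have D: "card ?D' = card ?D"
  proof (rule bij_betw_same_card[of q])
    show "bij_betw q ?D' ?D"
      unfolding bij_betw_def
    proof
      show "inj_on q ?D'" using permutes_inj[OF assms] by (auto simp: inj_on_def)
      show "q ` ?D' = ?D"
      proof (intro Set.set_eqI iffI)
        fix j assume "j \<in> q ` ?D'"
        then show "j \<in> ?D" using permutes_in_image[OF assms] by auto
      next
        fix j assume "j \<in> ?D"
        then have "inv' q j \<in> ?D'" "q (inv' q j) = j"
          using permutes_inverses[OF assms] permutes_in_image[OF permutes_inv[OF assms], of j]
          by auto
        then show "j \<in> q ` ?D'" by (intro image_eqI[where x = "inv' q j"]) simp_all
      qed
    qed
  qed
  have 1: "card {i \<in> {1..n}. (p \<circ> q) i = i} \<le> card ({i \<in> {1..n}. q i = i} \<union> ?D')"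
    by (rule card_mono) auto
  have 2: "card {i \<in> {1..n}. q i = i} \<le> card ({i \<in> {1..n}. (p \<circ> q) i = i} \<union> ?D')"
    by (rule card_mono) auto
  have "\<bar>real (card {i \<in> {1..n}. (p \<circ> q) i = i}) - real (card {i \<in> {1..n}. q i = i})\<bar> \<le> real (card ?D)"
    using 1 2 D card_Un_le[of "{i \<in> {1..n}. q i = i}" ?D']
      card_Un_le[of "{i \<in> {1..n}. (p \<circ> q) i = i}" ?D'] by linarith
  then have "\<bar>real (card {i \<in> {1..n}. (p \<circ> q) i = i}) - real (card {i \<in> {1..n}. q i = i})\<bar> / n \<le> real (card ?D) / n"
    by (rule divide_right_mono) simp
  then show ?thesis
    by (simp add: perm_trace_def hamming_dist_def diff_divide_distrib[symmetric])
qed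

lemma ultra_trace_coset:
  assumes \<omega>: "free_ultrafilter \<omega>" and p: "p \<in> carrier (perm_seqs n)"
  shows "((\<lambda>k. perm_trace (n k) (p k)) \<longlongrightarrow> ultra_trace \<omega> n (null_seqs \<omega> n #>\<^bsub>perm_seqs n\<^esub> p)) \<omega>"
proof -
  let ?X = "null_seqs \<omega> n #>\<^bsub>perm_seqs n\<^esub> p"
  have "perm_trace (n k) (p k) \<in> {0..1}" for k
  proof -
    have "card {i \<in> {1..n k}. p k i = i} \<le> card {1..n k}" by (rule card_mono) auto
    then show ?thesis by (auto simp: perm_trace_def divide_le_eq)
  qed
  then obtain t where t: "((\<lambda>k. perm_trace (n k) (p k)) \<longlongrightarrow> t) \<omega>"
    using tendsto_free_ultrafilter[OF \<omega>, of "\<lambda>k. perm_trace (n k) (p k)"] by blast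
  have \<omega>0: "\<omega> \<noteq> bot" using \<omega> by (simp add: free_ultrafilter_def)
  have lim: "((\<lambda>k. perm_trace (n k) (q k)) \<longlongrightarrow> t) \<omega>" if "q \<in> ?X" for q
  proof -
    from that obtain z where z: "z \<in> null_seqs \<omega> n" "q = (\<lambda>k. z k \<circ> p k)"
      unfolding r_coset_def perm_seqs_mult by blast
    have "((\<lambda>k. perm_trace (n k) (q k) - perm_trace (n k) (p k)) \<longlongrightarrow> 0) \<omega>"
    proof (rule tendsto_rabs_zero_cancel, rule tendsto_sandwich[of "\<lambda>_. 0"])
      show "((\<lambda>k. hamming_dist (n k) (z k) id) \<longlongrightarrow> 0) \<omega>"
        using z by (simp add: null_seqs_def)
      show "\<forall>\<^sub>F k in \<omega>. \<bar>perm_trace (n k) (q k) - perm_trace (n k) (p k)\<bar> \<le> hamming_dist (n k) (z k) id"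
        using p z(2) perm_trace_dist unfolding perm_seqs_carrier by (intro always_eventually) auto
    qed auto
    from tendsto_add[OF this t] show ?thesis by simp
  qed
  have pX: "p \<in> ?X"
    by (rule group.rcos_self[OF perm_seqs_group p normal_imp_subgroup[OF null_seqs_normal]])
  have "ultra_trace \<omega> n ?X = t"
    unfolding ultra_trace_def
    by (rule the_equality) (use lim pX tendsto_unique[OF \<omega>0 _ t] in blast)+
  then show ?thesis using t by simp
qed


subsection \<open>Amplification\<close>

lemma amplify_perm_0 [simp]: "amplify_perm r p 0 = 0"
  by (simp add: amplify_perm_def)

lemma amplify_perm_Suc:
  "amplify_perm r p (Suc j) = Suc ((p (Suc (j div r)) - 1) * r + j mod r)"
  by (simp add: amplify_perm_def)

lemma permutes_Suc:
  assumes "p permutes {1..n}" shows "Suc (p (Suc j) - 1) = p (Suc j)"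
proof -
  have "p 0 = 0" using assms by (auto simp: permutes_def)
  then have "p (Suc j) \<noteq> 0" using permutes_inj[OF assms] by (metis injD nat.distinct(1))
  then show ?thesis by simp
qed

lemma amplify_perm_comp:
  assumes "r > 0" "q permutes {1..n}"
  shows "amplify_perm r (p \<circ> q) = amplify_perm r p \<circ> amplify_perm r q"
proof
  fix i show "amplify_perm r (p \<circ> q) i = (amplify_perm r p \<circ> amplify_perm r q) i"
    using assms permutes_Suc[OF assms(2)]
    by (cases i) (simp_all add: amplify_perm_Suc)
qed

lemma amplify_perm_id: "r > 0 \<Longrightarrow> amplify_perm r id = id"
  by (rule ext, rename_tac i, case_tac i) (simp_all add: amplify_perm_Suc)

lemma amplify_perm_permutes:
  assumes "r > 0" "p permutes {1..n}"
  shows "amplify_perm r p permutes {1..n * r}"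
proof -
  have pi: "inv' p permutes {1..n}" using assms(2) by (rule permutes_inv)
  have "amplify_perm r p \<circ> amplify_perm r (inv' p) = id" "amplify_perm r (inv' p) \<circ> amplify_perm r p = id"
    using amplify_perm_comp[OF assms(1) pi, of p] amplify_perm_comp[OF assms, of "inv' p"]
      permutes_inv_o[OF assms(2)] amplify_perm_id[OF assms(1)] by simp_all
  then have "bij (amplify_perm r p)" by (rule o_bij[rotated])
  moreover have "amplify_perm r p i = i" if "i \<notin> {1..n * r}" for i
  proof (cases i)
    case (Suc j)
    then have "n \<le> j div r" using that assms(1) by (simp add: less_eq_div_iff_mult_less_eq)
    then have "p (Suc (j div r)) = Suc (j div r)"
      using assms(2) by (intro permutes_not_in) auto
    then show ?thesis by (simp add: Suc amplify_perm_Suc)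
  qed simp
  ultimately show ?thesis unfolding permutes_def bij_iff by blast
qed

lemma hamming_dist_amplify:
  assumes "r > 0" "p permutes {1..n}"
  shows "hamming_dist (n * r) (amplify_perm r p) id = hamming_dist n p id"
proof -
  let ?f = "\<lambda>(i, j). Suc ((i - 1) * r + j)"
  let ?S = "{i \<in> {1..n}. p i \<noteq> id i}"
  have fix_iff: "amplify_perm r p (Suc j) = Suc j \<longleftrightarrow> p (Suc (j div r)) = Suc (j div r)" for j
  proof
    assume "amplify_perm r p (Suc j) = Suc j"
    then have "(p (Suc (j div r)) - 1) * r + j mod r = j" by (simp add: amplify_perm_Suc)
    then have "(p (Suc (j div r)) - 1) * r = j div r * r"
      by (metis add_right_cancel div_mult_mod_eq)
    then show "p (Suc (j div r)) = Suc (j div r)"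
      using assms(1) permutes_Suc[OF assms(2), of "j div r"] by simp
  qed (simp add: amplify_perm_Suc)
  have "bij_betw ?f (?S \<times> {..<r}) {i \<in> {1..n * r}. amplify_perm r p i \<noteq> id i}"
  proof (rule bij_betw_byWitness[where f' = "\<lambda>i. (Suc ((i - 1) div r), (i - 1) mod r)"])
    show "\<forall>a\<in>?S \<times> {..<r}. (\<lambda>i. (Suc ((i - 1) div r), (i - 1) mod r)) (?f a) = a"
      using assms(1) by auto
    show "\<forall>a\<in>{i \<in> {1..n * r}. amplify_perm r p i \<noteq> id i}. ?f (Suc ((a - 1) div r), (a - 1) mod r) = a"
      by auto
    show "?f ` (?S \<times> {..<r}) \<subseteq> {i \<in> {1..n * r}. amplify_perm r p i \<noteq> id i}"
    proof clarsimp
      fix i j assume i: "Suc 0 \<le> i" "i \<le> n" "p i \<noteq> i" and j: "j < r"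
      have "(i - 1) * r + j < (i - 1) * r + r" using j by simp
      also have "\<dots> = i * r" using i(1) by (cases i) auto
      also have "\<dots> \<le> n * r" using i by simp
      finally have "Suc ((i - 1) * r + j) \<le> n * r" by simp
      moreover have "amplify_perm r p (Suc ((i - 1) * r + j)) \<noteq> Suc ((i - 1) * r + j)"
        unfolding fix_iff using i j assms(1) by simp
      ultimately show "Suc ((i - Suc 0) * r + j) \<le> n * r \<and>
          amplify_perm r p (Suc ((i - Suc 0) * r + j)) \<noteq> Suc ((i - Suc 0) * r + j)"
        by simp
    qed
    show "(\<lambda>i. (Suc ((i - 1) div r), (i - 1) mod r)) ` {i \<in> {1..n * r}. amplify_perm r p i \<noteq> id i} \<subseteq> ?S \<times> {..<r}"
    proof clarsimp
      fix i assume i: "Suc 0 \<le> i" "i \<le> n * r" "amplify_perm r p i \<noteq> i"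
      then obtain j where j: "i = Suc j" by (cases i) auto
      have "j div r < n" using i j assms(1) by (simp add: less_mult_imp_div_less)
      then show "Suc ((i - Suc 0) div r) \<le> n \<and>
          p (Suc ((i - Suc 0) div r)) \<noteq> Suc ((i - Suc 0) div r) \<and> (i - Suc 0) mod r < r"
        using i j assms(1) fix_iff[of j] by simp
    qed
  qed
  from bij_betw_same_card[OF this]
  have "card {i \<in> {1..n * r}. amplify_perm r p i \<noteq> id i} = card ?S * r"
    by (simp add: card_cartesian_product)
  then show ?thesis
    using assms(1) by (simp add: hamming_dist_def)
qed

lemma amplify_perm_amplify_perm: "amplify_perm s (amplify_perm r p) = amplify_perm (r * s) p"
proof
  fix i show "amplify_perm s (amplify_perm r p) i = amplify_perm (r * s) p i"
  proof (cases i)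
    case (Suc j)
    have "j mod (s * r) = s * (j div s mod r) + j mod s" by (rule mod_mult2_eq)
    moreover have "j div (s * r) = j div s div r" by (rule div_mult2_eq)
    ultimately show ?thesis
      by (simp add: Suc amplify_perm_Suc algebra_simps)
  qed simp
qed

context
  fixes \<omega> :: "nat filter" and n r :: "nat \<Rightarrow> nat"
  assumes r: "\<And>k. r k > 0"
begin

lemma amplify_seq_carrier:
  "p \<in> carrier (perm_seqs n) \<Longrightarrow> (\<lambda>k. amplify_perm (r k) (p k)) \<in> carrier (perm_seqs (\<lambda>k. n k * r k))"
  unfolding perm_seqs_carrier using r amplify_perm_permutes by blast

lemma amplify_coset:
  assumes p: "p \<in> carrier (perm_seqs n)"
  shows "amplify \<omega> n r (null_seqs \<omega> n #>\<^bsub>perm_seqs n\<^esub> p) =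
    null_seqs \<omega> (\<lambda>k. n k * r k) #>\<^bsub>perm_seqs (\<lambda>k. n k * r k)\<^esub> (\<lambda>k. amplify_perm (r k) (p k))"
    (is "_ = ?N #>\<^bsub>?P\<^esub> ?A p")
proof -
  interpret N: normal ?N ?P by (rule null_seqs_normal)
  have eq: "?N #>\<^bsub>?P\<^esub> ?A q = ?N #>\<^bsub>?P\<^esub> ?A p" if "q \<in> null_seqs \<omega> n #>\<^bsub>perm_seqs n\<^esub> p" for q
  proof -
    from that obtain z where z: "z \<in> null_seqs \<omega> n" "q = (\<lambda>k. z k \<circ> p k)"
      unfolding r_coset_def perm_seqs_mult by blast
    have zc: "z \<in> carrier (perm_seqs n)" using z by (simp add: null_seqs_def)
    have "hamming_dist (n k * r k) (amplify_perm (r k) (z k)) id = hamming_dist (n k) (z k) id" for k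
      using zc r hamming_dist_amplify unfolding perm_seqs_carrier by blast
    then have "?A z \<in> ?N"
      using z amplify_seq_carrier[OF zc] unfolding null_seqs_def by simp
    moreover have "?A q = ?A z \<otimes>\<^bsub>?P\<^esub> ?A p"
      unfolding z(2) perm_seqs_mult using p r amplify_perm_comp unfolding perm_seqs_carrier by blast
    ultimately have "?A q \<in> ?N #>\<^bsub>?P\<^esub> ?A p"
      unfolding r_coset_def by blast
    then show ?thesis
      using N.repr_independence[OF _ amplify_seq_carrier[OF p] N.subgroup_axioms] by simp
  qed
  have "p \<in> null_seqs \<omega> n #>\<^bsub>perm_seqs n\<^esub> p"
    by (rule group.rcos_self[OF perm_seqs_group p normal_imp_subgroup[OF null_seqs_normal]])
  then show ?thesis
    unfolding amplify_def using eq by blast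
qed

lemma amplify_hom: "amplify \<omega> n r \<in> hom (ultraprod \<omega> n) (ultraprod \<omega> (\<lambda>k. n k * r k))"
    (is "_ \<in> hom ?U ?V")
proof (rule homI)
  let ?m = "\<lambda>k. n k * r k"
  interpret N: normal "null_seqs \<omega> n" "perm_seqs n" by (rule null_seqs_normal)
  interpret M: normal "null_seqs \<omega> ?m" "perm_seqs ?m" by (rule null_seqs_normal)
  fix X assume "X \<in> carrier ?U"
  then obtain p where p: "p \<in> carrier (perm_seqs n)" "X = null_seqs \<omega> n #>\<^bsub>perm_seqs n\<^esub> p"
    unfolding ultraprod_def carrier_FactGroup by blast
  show "amplify \<omega> n r X \<in> carrier ?V"
    unfolding p(2) amplify_coset[OF p(1)] ultraprod_def carrier_FactGroup
    using amplify_seq_carrier[OF p(1)] by blast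
  fix Y assume "Y \<in> carrier ?U"
  then obtain q where q: "q \<in> carrier (perm_seqs n)" "Y = null_seqs \<omega> n #>\<^bsub>perm_seqs n\<^esub> q"
    unfolding ultraprod_def carrier_FactGroup by blast
  have XY: "X \<otimes>\<^bsub>?U\<^esub> Y = null_seqs \<omega> n #>\<^bsub>perm_seqs n\<^esub> (p \<otimes>\<^bsub>perm_seqs n\<^esub> q)"
    unfolding ultraprod_def mult_FactGroup p(2) q(2) by (rule N.rcos_sum[OF p(1) q(1)])
  have pq: "(\<lambda>k. amplify_perm (r k) ((p \<otimes>\<^bsub>perm_seqs n\<^esub> q) k)) =
      (\<lambda>k. amplify_perm (r k) (p k)) \<otimes>\<^bsub>perm_seqs ?m\<^esub> (\<lambda>k. amplify_perm (r k) (q k))"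
    unfolding perm_seqs_mult using q r amplify_perm_comp unfolding perm_seqs_carrier by blast
  show "amplify \<omega> n r (X \<otimes>\<^bsub>?U\<^esub> Y) = amplify \<omega> n r X \<otimes>\<^bsub>?V\<^esub> amplify \<omega> n r Y"
    unfolding XY amplify_coset[OF N.m_closed[OF p(1) q(1)]] pq
    unfolding p(2) q(2) amplify_coset[OF p(1)] amplify_coset[OF q(1)] ultraprod_def mult_FactGroup
    by (rule M.rcos_sum[symmetric]) (intro amplify_seq_carrier p q)+
qed

end

lemma amplify_amplify:
  assumes r: "\<And>k. r k > 0" and s: "\<And>k. s k > 0" and X: "X \<in> carrier (ultraprod \<omega> n)"
  shows "amplify \<omega> (\<lambda>k. n k * r k) s (amplify \<omega> n r X) = amplify \<omega> n (\<lambda>k. r k * s k) X"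
proof -
  obtain p where p: "p \<in> carrier (perm_seqs n)" "X = null_seqs \<omega> n #>\<^bsub>perm_seqs n\<^esub> p"
    using X unfolding ultraprod_def carrier_FactGroup by blast
  have rs: "\<And>k. r k * s k > 0" using r s by simp
  show ?thesis
    unfolding p(2) amplify_coset[OF r p(1)] amplify_coset[OF rs p(1)]
      amplify_coset[OF s amplify_seq_carrier[OF r p(1)]] amplify_perm_amplify_perm
    by (simp only: mult.assoc)
qed


subsection \<open>Equivalence and restriction of sofic representations\<close>

lemma sofic_reps_closed:
  "(n, \<Theta>) \<in> sofic_reps \<omega> H \<Longrightarrow> g \<in> carrier H \<Longrightarrow> \<Theta> g \<in> carrier (ultraprod \<omega> n)"
  by (auto simp: sofic_reps_def hom_def)

lemma conjugate_reps_amplify: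
  assumes "conjugate_reps \<omega> H (m, \<Theta>) (m, \<Phi>)" "\<And>k. r k > 0"
    "\<And>g. g \<in> carrier H \<Longrightarrow> \<Theta> g \<in> carrier (ultraprod \<omega> m)"
  shows "conjugate_reps \<omega> H (amplify_rep \<omega> H r (m, \<Theta>)) (amplify_rep \<omega> H r (m, \<Phi>))"
proof -
  let ?U = "ultraprod \<omega> m" and ?V = "ultraprod \<omega> (\<lambda>k. m k * r k)"
  interpret h: group_hom ?U ?V "amplify \<omega> m r"
    using amplify_hom[of r \<omega> m] assms(2)
    by (intro group_hom.intro ultraprod_group group_hom_axioms.intro) auto
  obtain u where u: "u \<in> carrier ?U" "\<forall>g\<in>carrier H. \<Phi> g = u \<otimes>\<^bsub>?U\<^esub> \<Theta> g \<otimes>\<^bsub>?U\<^esub> inv\<^bsub>?U\<^esub> u"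
    using assms(1) by (auto simp: conjugate_reps_def)
  show ?thesis
    unfolding conjugate_reps_def amplify_rep_def
    using u assms(3) by (auto intro!: bexI[of _ "amplify \<omega> m r u"])
qed

lemma amplify_rep_amplify_rep:
  assumes "\<And>k. r k > 0" "\<And>k. s k > 0" "\<And>g. g \<in> carrier H \<Longrightarrow> \<Theta> g \<in> carrier (ultraprod \<omega> n)"
  shows "amplify_rep \<omega> H s (amplify_rep \<omega> H r (n, \<Theta>)) = amplify_rep \<omega> H (\<lambda>k. r k * s k) (n, \<Theta>)"
  using amplify_amplify[OF assms(1,2,3)]
  by (auto simp: amplify_rep_def mult.assoc restrict_def fun_eq_iff)

lemma conjugate_reps_sym:
  assumes "conjugate_reps \<omega> H (m, \<Theta>) (m', \<Phi>)"
    "\<And>g. g \<in> carrier H \<Longrightarrow> \<Theta> g \<in> carrier (ultraprod \<omega> m)"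
  shows "conjugate_reps \<omega> H (m', \<Phi>) (m, \<Theta>)"
proof -
  interpret U: group "ultraprod \<omega> m" by (rule ultraprod_group)
  obtain u where m: "m' = m" and u: "u \<in> carrier (ultraprod \<omega> m)"
    "\<forall>g\<in>carrier H. \<Phi> g = u \<otimes>\<^bsub>ultraprod \<omega> m\<^esub> \<Theta> g \<otimes>\<^bsub>ultraprod \<omega> m\<^esub> inv\<^bsub>ultraprod \<omega> m\<^esub> u"
    using assms(1) by (auto simp: conjugate_reps_def)
  have "\<Theta> g = inv\<^bsub>ultraprod \<omega> m\<^esub> u \<otimes>\<^bsub>ultraprod \<omega> m\<^esub> \<Phi> g \<otimes>\<^bsub>ultraprod \<omega> m\<^esub> inv\<^bsub>ultraprod \<omega> m\<^esub> (inv\<^bsub>ultraprod \<omega> m\<^esub> u)"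
    if g: "g \<in> carrier H" for g
  proof -
    have "inv\<^bsub>ultraprod \<omega> m\<^esub> u \<otimes>\<^bsub>ultraprod \<omega> m\<^esub> (u \<otimes>\<^bsub>ultraprod \<omega> m\<^esub> x) = x"
      if "x \<in> carrier (ultraprod \<omega> m)" for x
      using that u(1) by (simp add: U.m_assoc[symmetric])
    then show ?thesis
      using u g assms(2)[OF g] by (simp add: U.m_assoc)
  qed
  then show ?thesis
    unfolding conjugate_reps_def m prod.case using U.inv_closed[OF u(1)] by blast
qed

lemma conjugate_reps_trans:
  assumes "conjugate_reps \<omega> H (m, \<Theta>) (m', \<Phi>)" "conjugate_reps \<omega> H (m', \<Phi>) (m'', \<Psi>)"
    "\<And>g. g \<in> carrier H \<Longrightarrow> \<Theta> g \<in> carrier (ultraprod \<omega> m)"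
  shows "conjugate_reps \<omega> H (m, \<Theta>) (m'', \<Psi>)"
proof -
  let ?U = "ultraprod \<omega> m"
  interpret U: group ?U by (rule ultraprod_group)
  obtain u v where m: "m' = m" "m'' = m" and uv: "u \<in> carrier ?U" "v \<in> carrier ?U"
    "\<forall>g\<in>carrier H. \<Phi> g = u \<otimes>\<^bsub>?U\<^esub> \<Theta> g \<otimes>\<^bsub>?U\<^esub> inv\<^bsub>?U\<^esub> u"
    "\<forall>g\<in>carrier H. \<Psi> g = v \<otimes>\<^bsub>?U\<^esub> \<Phi> g \<otimes>\<^bsub>?U\<^esub> inv\<^bsub>?U\<^esub> v"
    using assms(1,2) unfolding conjugate_reps_def prod.case by blast
  have "\<Psi> g = (v \<otimes>\<^bsub>?U\<^esub> u) \<otimes>\<^bsub>?U\<^esub> \<Theta> g \<otimes>\<^bsub>?U\<^esub> inv\<^bsub>?U\<^esub> (v \<otimes>\<^bsub>?U\<^esub> u)"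
    if g: "g \<in> carrier H" for g
    using uv(1,2) assms(3)[OF g]
    by (simp add: uv(4)[rule_format, OF g] uv(3)[rule_format, OF g] U.m_assoc U.inv_mult_group)
  then show ?thesis
    unfolding conjugate_reps_def m prod.case using U.m_closed[OF uv(2,1)] by blast
qed

lemma amplify_rep_closed:
  assumes "(n, \<Theta>) \<in> sofic_reps \<omega> H" "\<And>k. r k > 0" "g \<in> carrier H"
  shows "snd (amplify_rep \<omega> H r (n, \<Theta>)) g \<in> carrier (ultraprod \<omega> (fst (amplify_rep \<omega> H r (n, \<Theta>))))"
  using amplify_hom[of r \<omega> n, OF assms(2)] sofic_reps_closed[OF assms(1,3)] assms(3)
  by (auto simp: amplify_rep_def hom_def)

theorem equiv_sofic_equiv: "equiv (sofic_reps \<omega> H) (sofic_equiv \<omega> H)"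
proof (rule equivI)
  show "sofic_equiv \<omega> H \<subseteq> sofic_reps \<omega> H \<times> sofic_reps \<omega> H"
    by (auto simp: sofic_equiv_def)
  show "refl_on (sofic_reps \<omega> H) (sofic_equiv \<omega> H)"
  proof (rule refl_onI)
    fix x assume x: "x \<in> sofic_reps \<omega> H"
    obtain n \<Theta> where xn: "x = (n, \<Theta>)" by force
    have cl: "amplify \<omega> n (\<lambda>_. 1) (\<Theta> g) \<in> carrier (ultraprod \<omega> n)" if "g \<in> carrier H" for g
      using amplify_rep_closed[OF x[unfolded xn], of "\<lambda>_. 1" g] that
      by (simp add: amplify_rep_def)
    interpret U: group "ultraprod \<omega> n" by (rule ultraprod_group)
    have "conjugate_reps \<omega> H (amplify_rep \<omega> H (\<lambda>_. 1) x) (amplify_rep \<omega> H (\<lambda>_. 1) x)"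
      unfolding xn conjugate_reps_def amplify_rep_def
      using cl by (auto intro!: bexI[of _ "\<one>\<^bsub>ultraprod \<omega> n\<^esub>"])
    then show "(x, x) \<in> sofic_equiv \<omega> H"
      using x unfolding sofic_equiv_def by (auto intro!: exI[of _ "\<lambda>_. 1"])
  qed
  show "sym (sofic_equiv \<omega> H)"
  proof (rule symI)
    fix x y assume "(x, y) \<in> sofic_equiv \<omega> H"
    then obtain r s where xy: "x \<in> sofic_reps \<omega> H" "y \<in> sofic_reps \<omega> H"
      and rs: "\<And>k. r k > 0" "\<And>k. s k > 0"
      and c: "conjugate_reps \<omega> H (amplify_rep \<omega> H r x) (amplify_rep \<omega> H s y)"
      by (auto simp: sofic_equiv_def)
    have "conjugate_reps \<omega> H (amplify_rep \<omega> H s y) (amplify_rep \<omega> H r x)"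
      using conjugate_reps_sym[of \<omega> H "fst (amplify_rep \<omega> H r x)" "snd (amplify_rep \<omega> H r x)"
          "fst (amplify_rep \<omega> H s y)" "snd (amplify_rep \<omega> H s y)"] c
        amplify_rep_closed[of "fst x" "snd x" \<omega> H r] xy rs by simp
    then show "(y, x) \<in> sofic_equiv \<omega> H"
      using xy rs by (auto simp: sofic_equiv_def)
  qed
  show "trans (sofic_equiv \<omega> H)"
  proof (rule transI)
    fix x y z assume "(x, y) \<in> sofic_equiv \<omega> H" "(y, z) \<in> sofic_equiv \<omega> H"
    then obtain r s t w where xyz: "x \<in> sofic_reps \<omega> H" "y \<in> sofic_reps \<omega> H" "z \<in> sofic_reps \<omega> H"
      and pos: "\<And>k. r k > 0" "\<And>k. s k > 0" "\<And>k. t k > 0" "\<And>k. w k > 0"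
      and c: "conjugate_reps \<omega> H (amplify_rep \<omega> H r x) (amplify_rep \<omega> H s y)"
      and d: "conjugate_reps \<omega> H (amplify_rep \<omega> H t y) (amplify_rep \<omega> H w z)"
      unfolding sofic_equiv_def by blast
    have amp: "conjugate_reps \<omega> H (amplify_rep \<omega> H (\<lambda>k. p k * l k) x') (amplify_rep \<omega> H (\<lambda>k. q k * l k) y')"
      if "conjugate_reps \<omega> H (amplify_rep \<omega> H p x') (amplify_rep \<omega> H q y')"
        "x' \<in> sofic_reps \<omega> H" "y' \<in> sofic_reps \<omega> H" "\<And>k. p k > 0" "\<And>k. q k > 0" "\<And>k. l k > 0"
      for p q l x' y'
    proof -
      obtain n \<Theta> n' \<Theta>' where x': "x' = (n, \<Theta>)" and y': "y' = (n', \<Theta>')" by force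
      have m: "(\<lambda>k. n' k * q k) = (\<lambda>k. n k * p k)"
        using that(1) by (auto simp: x' y' conjugate_reps_def amplify_rep_def)
      have "conjugate_reps \<omega> H (amplify_rep \<omega> H l (amplify_rep \<omega> H p x')) (amplify_rep \<omega> H l (amplify_rep \<omega> H q y'))"
        using conjugate_reps_amplify[of \<omega> H "\<lambda>k. n k * p k" "snd (amplify_rep \<omega> H p x')"
            "snd (amplify_rep \<omega> H q y')" l] that(1) amplify_rep_closed[of n \<Theta> \<omega> H p] that
        by (simp add: x' y' amplify_rep_def m)
      moreover have "amplify_rep \<omega> H l (amplify_rep \<omega> H p x') = amplify_rep \<omega> H (\<lambda>k. p k * l k) x'"
        unfolding x' by (rule amplify_rep_amplify_rep) (use that x' sofic_reps_closed in auto)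
      moreover have "amplify_rep \<omega> H l (amplify_rep \<omega> H q y') = amplify_rep \<omega> H (\<lambda>k. q k * l k) y'"
        unfolding y' by (rule amplify_rep_amplify_rep) (use that y' sofic_reps_closed in auto)
      ultimately show ?thesis by simp
    qed
    have 1: "conjugate_reps \<omega> H (amplify_rep \<omega> H (\<lambda>k. r k * t k) x) (amplify_rep \<omega> H (\<lambda>k. s k * t k) y)"
      by (rule amp[OF c]) (use xyz pos in auto)
    have 2: "conjugate_reps \<omega> H (amplify_rep \<omega> H (\<lambda>k. s k * t k) y) (amplify_rep \<omega> H (\<lambda>k. w k * s k) z)"
      using amp[where l = s, OF d xyz(2,3) pos(3,4,2)] by (simp add: mult.commute)
    have rt: "\<And>k. r k * t k > 0" using pos by simp
    have "conjugate_reps \<omega> H (amplify_rep \<omega> H (\<lambda>k. r k * t k) x) (amplify_rep \<omega> H (\<lambda>k. w k * s k) z)"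
      (is "conjugate_reps _ _ ?X ?Z")
    proof -
      let ?Y = "amplify_rep \<omega> H (\<lambda>k. s k * t k) y"
      have "conjugate_reps \<omega> H (fst ?X, snd ?X) (fst ?Z, snd ?Z)"
      proof (rule conjugate_reps_trans)
        show "conjugate_reps \<omega> H (fst ?X, snd ?X) (fst ?Y, snd ?Y)"
          using 1 by (simp only: prod.collapse)
        show "conjugate_reps \<omega> H (fst ?Y, snd ?Y) (fst ?Z, snd ?Z)"
          using 2 by (simp only: prod.collapse)
        show "snd ?X g \<in> carrier (ultraprod \<omega> (fst ?X))" if "g \<in> carrier H" for g
          using amplify_rep_closed[of "fst x" "snd x" \<omega> H "\<lambda>k. r k * t k" g] xyz(1) rt that
          by (simp only: prod.collapse)
      qed
      then show ?thesis by (simp only: prod.collapse)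
    qed
    then have "\<exists>r s. (\<forall>k. r k > 0 \<and> s k > 0) \<and>
        conjugate_reps \<omega> H (amplify_rep \<omega> H r x) (amplify_rep \<omega> H s z)"
      using pos by (intro exI[of _ "\<lambda>k. r k * t k"] exI[of _ "\<lambda>k. w k * s k"]) simp
    then show "(x, z) \<in> sofic_equiv \<omega> H"
      using xyz by (simp add: sofic_equiv_def)
  qed
qed

context
  fixes \<omega> :: "nat filter" and G K :: "('g, 'm) monoid_scheme" and S :: "'g set"
  assumes G: "group G" and K: "K = subgroup_generated G S"
begin

lemma restrict_rep_sofic:
  assumes "x \<in> sofic_reps \<omega> G" shows "restrict_rep K x \<in> sofic_reps \<omega> K"
proof -
  have sub: "g \<in> carrier G" if "g \<in> carrier K" for g
    using that group.carrier_subgroup_generated_subset[OF G] unfolding K by blast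
  interpret K: group K unfolding K by (rule group.group_subgroup_generated[OF G])
  have mult: "mult K = mult G" and one: "one K = one G"
    by (simp_all add: K)
  obtain n \<Theta> where x: "x = (n, \<Theta>)" by force
  have \<Theta>: "\<forall>k. n k > 0" "filterlim n at_top sequentially" "\<Theta> \<in> hom G (ultraprod \<omega> n)"
    "\<And>g. g \<in> carrier G \<Longrightarrow> g \<noteq> \<one>\<^bsub>G\<^esub> \<Longrightarrow> ultra_trace \<omega> n (\<Theta> g) = 0"
    using assms by (auto simp: sofic_reps_def x)
  have "restrict \<Theta> (carrier K) \<in> hom K (ultraprod \<omega> n)"
  proof (rule homI)
    fix g h assume gh: "g \<in> carrier K" "h \<in> carrier K"
    show "restrict \<Theta> (carrier K) g \<in> carrier (ultraprod \<omega> n)"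
      using hom_in_carrier[OF \<Theta>(3) sub[OF gh(1)]] gh by simp
    show "restrict \<Theta> (carrier K) (g \<otimes>\<^bsub>K\<^esub> h) =
        restrict \<Theta> (carrier K) g \<otimes>\<^bsub>ultraprod \<omega> n\<^esub> restrict \<Theta> (carrier K) h"
      using hom_mult[OF \<Theta>(3) sub[OF gh(1)] sub[OF gh(2)]] gh K.m_closed[OF gh] by (simp add: mult)
  qed
  then show ?thesis
    using \<Theta> sub by (simp add: sofic_reps_def restrict_rep_def x one)
qed

lemma restrict_rep_equiv:
  assumes "(x, y) \<in> sofic_equiv \<omega> G"
  shows "(restrict_rep K x, restrict_rep K y) \<in> sofic_equiv \<omega> K"
proof -
  have sub: "carrier K \<subseteq> carrier G"
    unfolding K by (rule group.carrier_subgroup_generated_subset[OF G])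
  obtain r s where xy: "x \<in> sofic_reps \<omega> G" "y \<in> sofic_reps \<omega> G"
    and rs: "\<And>k. r k > 0" "\<And>k. s k > 0"
    and c: "conjugate_reps \<omega> G (amplify_rep \<omega> G r x) (amplify_rep \<omega> G s y)"
    using assms by (auto simp: sofic_equiv_def)
  have "conjugate_reps \<omega> K (amplify_rep \<omega> K r (restrict_rep K x)) (amplify_rep \<omega> K s (restrict_rep K y))"
    using c sub unfolding conjugate_reps_def amplify_rep_def restrict_rep_def
    by (fastforce split: prod.splits)
  then show ?thesis
    using xy rs restrict_rep_sofic by (auto simp: sofic_equiv_def)
qed

theorem restriction_map_class:
  assumes "x \<in> sofic_reps \<omega> G"
  shows "restriction_map \<omega> K (sofic_equiv \<omega> G `` {x}) = sofic_equiv \<omega> K `` {restrict_rep K x}"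
proof -
  have "(x, x) \<in> sofic_equiv \<omega> G"
    using equiv_sofic_equiv assms by (metis equiv_def refl_onD)
  moreover have "sofic_equiv \<omega> K `` {restrict_rep K y} = sofic_equiv \<omega> K `` {restrict_rep K x}"
    if "(x, y) \<in> sofic_equiv \<omega> G" for y
    using equiv_class_eq[OF equiv_sofic_equiv restrict_rep_equiv[OF that]] by simp
  ultimately show ?thesis
    unfolding restriction_map_def by blast
qed

theorem restriction_map_Sof: "restriction_map \<omega> K \<in> Sof \<omega> G \<rightarrow> Sof \<omega> K"
proof
  fix C assume "C \<in> Sof \<omega> G"
  then obtain x where x: "x \<in> sofic_reps \<omega> G" "C = sofic_equiv \<omega> G `` {x}"
    unfolding Sof_def by (rule quotientE)
  show "restriction_map \<omega> K C \<in> Sof \<omega> K"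
    unfolding x(2) restriction_map_class[OF x(1)] Sof_def
    by (rule quotientI) (rule restrict_rep_sofic[OF x(1)])
qed

end

end

theory Submission
  imports Defs
begin

text \<open>Suppose that an amplification of a representation \<open>\<Theta>\<close> of \<open>F2\<close> is conjugate to the restriction of a representation of
\<open>G\<close>. Then the image of \<open>b\<close> gives an element of the ultraproduct that conjugates the amplified \<open>\<Theta>(a)\<close> to \<open>\<Theta>(c)\<close> and
\<open>\<Theta>(c)\<close> to \<open>\<Theta>(a)\<close> (\<open>restriction_swaps_gens\<close>). So it suffices to construct \<open>\<Theta>\<close> such that the pairs
\<open>(\<Theta>(a), \<Theta>(c))\<close> and \<open>(\<Theta>(c), \<Theta>(a))\<close> are not conjugate, even after amplification.

The pairs are told apart by labellings of the underlying finite sets with two labels. The finite models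
\<open>a\<close>, \<open>c\<close> of \<open>\<Theta>\<close> on \<open>{1..n}\<close> have a labelling \<open>h\<close> that \<open>a\<close> preserves and \<open>c\<close> flips, but every labelling that \<open>a\<close> is
supposed to flip and \<open>c\<close> to preserve fails at a proportion of at least \<open>1 / 384\<close> of the points. If \<open>\<beta>\<close> almost
exchanged \<open>a\<close> and \<open>c\<close> by conjugation, then the labelling obtained from \<open>h\<close> by composition with \<open>\<beta>\<close> would be almost flipped
by \<open>a\<close> and almost preserved by \<open>c\<close> (\<open>swap_gap\<close>). Amplification does not help, since a labelling of an amplified
model is a family of labellings of the model and the failures average (\<open>defect_amplify\<close>).

The models live on two copies of \<open>{..<N}\<close>: \<open>a\<close> acts on each copy as the cyclic shift, while \<open>c\<close> exchanges the copies and acts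
as a permutation \<open>t\<close> within them; \<open>h\<close> tells the copies apart. The permutation \<open>t\<close> is chosen at random, subject to
two requirements. First, every reduced word must have few fixed points, which makes \<open>\<Theta>\<close> sofic; the expected number
of fixed points is bounded independently of \<open>N\<close>, because a walk that reveals the values of \<open>t\<close> one after the other is
unlikely to meet itself (\<open>sum_fixed_points\<close>). Secondly, there must be no forbidden labelling. Such a labelling almost alternates
along both cycles. There are only \<open>2 ^ (\<epsilon> N)\<close> almost alternating labellings, and each uses both labels about equally
often, so the condition that \<open>t\<close> almost preserves it holds with a probability that is exponentially small in \<open>N\<close>
with a much better rate (\<open>card_bad_perms\<close>). The two estimates together provide \<open>t\<close> (\<open>ex_balanced_perm\<close>).\<close>

section \<open>Words as permutations\<close>

fun word_perm :: "('g \<Rightarrow> 'v \<Rightarrow> 'v) \<Rightarrow> 'g word \<Rightarrow> 'v \<Rightarrow> 'v" where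
  "word_perm p [] = id"
| "word_perm p ((x, e) # u) = (if e then inv' (p x) else p x) \<circ> word_perm p u"

lemma word_perm_append: "word_perm p (u @ v) = word_perm p u \<circ> word_perm p v"
  by (induction p u rule: word_perm.induct) (auto simp: fun_eq_iff)

lemma word_perm_permutes:
  assumes "\<And>x. p x permutes S"
  shows "word_perm p u permutes S"
proof (induction u)
  case (Cons l u)
  then show ?case
    using assms permutes_inv[OF assms] by (cases l) (auto simp del: comp_apply intro!: permutes_compose)
qed (simp only: word_perm.simps permutes_id)

lemma word_perm_cong:
  assumes "\<And>x. bij (p x)" and "word_cong {} u v"
  shows "word_perm p u = word_perm p v"
  using assms(2)
proof (induction rule: word_cong.induct)
  case (cancel x e)
  show ?case
    using assms(1)[of x] by (auto simp: fun_eq_iff bij_is_inj bij_is_surj surj_f_inv_f)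
qed (simp_all add: word_perm_append)

fun reduced :: "'g word \<Rightarrow> bool" where
  "reduced ((x, e) # (y, d) # u) \<longleftrightarrow> (x = y \<longrightarrow> d = e) \<and> reduced ((y, d) # u)"
| "reduced _ \<longleftrightarrow> True"

lemma reduced_Cons: "reduced (l # u) \<Longrightarrow> reduced u"
  by (cases "l # u" rule: reduced.cases) auto

lemma ex_reduced: "\<exists>v. reduced v \<and> word_cong R u v"
proof (induction u)
  case Nil
  show ?case by (rule exI[of _ "[]"]) (auto intro: word_cong.refl)
next
  case (Cons l u)
  then obtain v where v: "reduced v" "word_cong R u v" by blast
  obtain x e where l: "l = (x, e)" by force
  have lv: "word_cong R (l # u) (l # v)"
    using word_cong.append[OF word_cong.refl[of R "[l]"] v(2)] by simp
  show ?case
  proof (cases "\<exists>w. v = (x, \<not> e) # w")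
    case True
    then obtain w where w: "v = (x, \<not> e) # w" by blast
    have "word_cong R (l # v) w"
      using word_cong.append[OF word_cong.cancel[of R x e] word_cong.refl[of R w]] by (simp add: w l)
    then show ?thesis
      using lv v(1) w reduced_Cons word_cong.trans by metis
  next
    case False
    then have "reduced (l # v)"
      using v(1) by (cases v) (auto simp: l)
    then show ?thesis using lv by blast
  qed
qed

lemma reduced_leading_power:
  assumes "reduced u"
  obtains k d v where "u = replicate k (Gen_A, d) @ v" "v = [] \<or> (\<exists>e w. v = (Gen_B, e) # w)"
  using assms
proof (induction u arbitrary: thesis)
  case (Cons l u)
  obtain x e where l: "l = (x, e)" by force
  show ?case
  proof (cases x)
    case Gen_A
    obtain k d v where u: "u = replicate k (Gen_A, d) @ v" "v = [] \<or> (\<exists>e w. v = (Gen_B, e) # w)"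
      using Cons.IH reduced_Cons[OF Cons.prems(2)] by metis
    have "k = 0 \<or> d = e"
      using Cons.prems(2) u by (cases k) (auto simp: l Gen_A)
    then have "l # u = replicate (Suc k) (Gen_A, e) @ v"
      by (auto simp: l Gen_A u)
    then show ?thesis using Cons.prems(1) u(2) by blast
  next
    case Gen_B
    then show ?thesis using Cons.prems(1)[of 0 True "l # u"] l by auto
  qed
qed (metis append_Nil replicate_0)

section \<open>Fixed points of words under a random permutation\<close>

text \<open>Let \<open>\<alpha>\<close> be fixed and \<open>t\<close> random. The image of \<open>i\<close> under a word is the end of a walk from \<open>i\<close>, traced by
the suffixes of the word. Each \<open>t\<close>-step of the walk reveals a new value of \<open>t\<close>, which with high
probability is far, in the sense of \<open>\<alpha>\<close>, from everything visited so far; a walk all of whose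
\<open>t\<close>-steps have this property cannot return to \<open>i\<close>.\<close>

abbreviation act :: "('v \<Rightarrow> 'v) \<Rightarrow> ('v \<Rightarrow> 'v) \<Rightarrow> gen word \<Rightarrow> 'v \<Rightarrow> 'v" where
  "act \<alpha> t \<equiv> word_perm (case_gen \<alpha> t)"

definition orbit_ball :: "('v \<Rightarrow> 'v) \<Rightarrow> nat \<Rightarrow> 'v set \<Rightarrow> 'v set" where
  "orbit_ball \<alpha> L S = {y. \<exists>s\<in>S. \<exists>k\<le>L. (\<alpha> ^^ k) s = y \<or> (\<alpha> ^^ k) y = s}"

fun visited :: "('v \<Rightarrow> 'v) \<Rightarrow> 'v \<Rightarrow> ('v \<Rightarrow> 'v) \<Rightarrow> gen word \<Rightarrow> 'v set" where
  "visited \<alpha> i t [] = {i}"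
| "visited \<alpha> i t (l # u) = insert (act \<alpha> t (l # u) i) (visited \<alpha> i t u)"

text \<open>The points within distance \<open>L\<close> are excluded rather than the visited points alone, because a walk may
move along \<open>\<alpha>\<close> by up to \<open>L\<close> steps before it reveals the next value of \<open>t\<close>.\<close>

fun spread_walk :: "('v \<Rightarrow> 'v) \<Rightarrow> nat \<Rightarrow> 'v \<Rightarrow> ('v \<Rightarrow> 'v) \<Rightarrow> gen word \<Rightarrow> bool" where
  "spread_walk \<alpha> L i t [] \<longleftrightarrow> True"
| "spread_walk \<alpha> L i t ((Gen_A, e) # u) \<longleftrightarrow> spread_walk \<alpha> L i t u"
| "spread_walk \<alpha> L i t ((Gen_B, e) # u) \<longleftrightarrow>
     spread_walk \<alpha> L i t u \<and> act \<alpha> t ((Gen_B, e) # u) i \<notin> orbit_ball \<alpha> L (visited \<alpha> i t u)"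

text \<open>The part of the graph of \<open>t\<close> on which the walk depends; an inverse letter uses its edge backwards.\<close>

fun used_edges :: "('v \<Rightarrow> 'v) \<Rightarrow> 'v \<Rightarrow> ('v \<Rightarrow> 'v) \<Rightarrow> gen word \<Rightarrow> ('v \<times> 'v) set" where
  "used_edges \<alpha> i t [] = {}"
| "used_edges \<alpha> i t ((Gen_A, e) # u) = used_edges \<alpha> i t u"
| "used_edges \<alpha> i t ((Gen_B, e) # u) =
     insert (if e then (act \<alpha> t ((Gen_B, e) # u) i, act \<alpha> t u i)
             else (act \<alpha> t u i, act \<alpha> t ((Gen_B, e) # u) i)) (used_edges \<alpha> i t u)"

lemma finite_visited: "finite (visited \<alpha> i t u)"
  by (induction u) auto

lemma card_visited: "card (visited \<alpha> i t u) \<le> Suc (length u)"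
  by (induction u) (auto simp: finite_visited card_insert_if)

lemma act_in_visited: "act \<alpha> t u i \<in> visited \<alpha> i t u"
  by (cases u) auto

lemma start_in_visited: "i \<in> visited \<alpha> i t u"
  by (induction u) auto

lemma used_edges_visited: "used_edges \<alpha> i t u \<subseteq> visited \<alpha> i t u \<times> visited \<alpha> i t u"
proof (induction u)
  case (Cons l u)
  obtain x e where l: "l = (x, e)" by force
  show ?case
    using Cons act_in_visited[of \<alpha> t u i] by (cases x; cases e) (auto simp: l)
qed simp

lemma orbit_ball_card:
  assumes "bij \<alpha>" "finite S"
  shows "finite (orbit_ball \<alpha> L S)" "card (orbit_ball \<alpha> L S) \<le> 2 * Suc L * card S"
proof -
  let ?f = "\<lambda>(k, b, s). if b then (\<alpha> ^^ k) s else inv' (\<alpha> ^^ k) s"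
  let ?T = "{..L} \<times> (UNIV :: bool set) \<times> S"
  have sub: "orbit_ball \<alpha> L S \<subseteq> ?f ` ?T"
  proof
    fix y assume "y \<in> orbit_ball \<alpha> L S"
    then obtain s k where sk: "s \<in> S" "k \<le> L" "(\<alpha> ^^ k) s = y \<or> (\<alpha> ^^ k) y = s"
      unfolding orbit_ball_def by blast
    have "inj (\<alpha> ^^ k)" using assms(1) by (simp add: bij_is_inj inj_fn)
    then have "y = ?f (k, True, s) \<or> y = ?f (k, False, s)"
      using sk(3) by (auto simp: inv_f_eq)
    then show "y \<in> ?f ` ?T"
      using sk(1,2) by blast
  qed
  have fin: "finite ?T" using assms(2) by simp
  show "finite (orbit_ball \<alpha> L S)" using sub fin finite_surj by blast
  have "card (orbit_ball \<alpha> L S) \<le> card ?T" using surj_card_le[OF fin sub] .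
  then show "card (orbit_ball \<alpha> L S) \<le> 2 * Suc L * card S"
    by (simp add: card_cartesian_product algebra_simps)
qed

lemma act_agree:
  assumes "bij t'" "bij t" "\<And>x y. (x, y) \<in> used_edges \<alpha> i t u \<Longrightarrow> t' x = y"
  shows "act \<alpha> t' u i = act \<alpha> t u i \<and> visited \<alpha> i t' u = visited \<alpha> i t u"
  using assms(3)
proof (induction u)
  case (Cons l u)
  obtain x e where l: "l = (x, e)" by force
  have IH: "act \<alpha> t' u i = act \<alpha> t u i" "visited \<alpha> i t' u = visited \<alpha> i t u"
    using Cons.IH Cons.prems by (cases x; auto simp: l)+
  have "act \<alpha> t' (l # u) i = act \<alpha> t (l # u) i"
  proof (cases x)
    case Gen_B
    show ?thesis
    proof (cases e)
      case True
      then have "t' (inv' t (act \<alpha> t u i)) = act \<alpha> t u i"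
        using Cons.prems[of "inv' t (act \<alpha> t u i)" "act \<alpha> t u i"] by (simp add: l Gen_B)
      then have "inv' t' (act \<alpha> t u i) = inv' t (act \<alpha> t u i)"
        by (metis assms(1) bij_inv_eq_iff)
      then show ?thesis by (simp add: l Gen_B True IH)
    next
      case False
      then show ?thesis
        using Cons.prems[of "act \<alpha> t u i" "t (act \<alpha> t u i)"] by (simp add: l Gen_B IH)
    qed
  qed (simp add: l IH)
  then show ?case using IH by simp
qed simp

lemma act_power_A:
  assumes "bij \<alpha>"
  shows "(\<alpha> ^^ k) (act \<alpha> t v i) = act \<alpha> t (replicate k (Gen_A, d) @ v) i \<or>
    (\<alpha> ^^ k) (act \<alpha> t (replicate k (Gen_A, d) @ v) i) = act \<alpha> t v i"
proof (cases d)
  case True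
  have "(\<alpha> ^^ k) (act \<alpha> t (replicate k (Gen_A, True) @ v) i) = act \<alpha> t v i"
  proof (induction k)
    case (Suc k)
    then show ?case
      using assms by (simp add: funpow_swap1 bij_is_surj surj_f_inv_f)
  qed simp
  then show ?thesis using True by simp
next
  case False
  have "(\<alpha> ^^ k) (act \<alpha> t v i) = act \<alpha> t (replicate k (Gen_A, False) @ v) i"
    by (induction k) auto
  then show ?thesis using False by simp
qed

lemma spread_walk_power_A: "spread_walk \<alpha> L i t (replicate k (Gen_A, d) @ v) = spread_walk \<alpha> L i t v"
  by (induction k) auto

lemma used_edges_power_A: "used_edges \<alpha> i t (replicate k (Gen_A, d) @ v) = used_edges \<alpha> i t v"
  by (induction k) auto

text \<open>Replacing \<open>t\<close> by its inverse exchanges the two letters of \<open>t\<close>, so a \<open>t\<close>-step in the inverse direction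
reduces to one in the forward direction.\<close>

definition flip_B :: "gen word \<Rightarrow> gen word" where
  "flip_B = map (\<lambda>(x, e). (x, if x = Gen_B then \<not> e else e))"

lemma flip_B_simps [simp]:
  "flip_B [] = []" "flip_B ((Gen_A, e) # u) = (Gen_A, e) # flip_B u"
  "flip_B ((Gen_B, e) # u) = (Gen_B, \<not> e) # flip_B u"
  by (simp_all add: flip_B_def)

lemma length_flip_B [simp]: "length (flip_B u) = length u"
  by (simp add: flip_B_def)

lemma reduced_flip_B: "reduced u \<Longrightarrow> reduced (flip_B u)"
  by (induction u rule: reduced.induct) (auto simp: flip_B_def)

lemma act_flip_B:
  assumes "bij t"
  shows "act \<alpha> (inv' t) (flip_B u) = act \<alpha> t u"
proof (induction u)
  case (Cons l u)
  then show ?case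
    using inv_inv_eq[OF assms] by (cases l; cases "fst l") auto
qed simp

lemma visited_flip_B:
  assumes "bij t"
  shows "visited \<alpha> i (inv' t) (flip_B u) = visited \<alpha> i t u"
proof (induction u)
  case (Cons l u)
  then show ?case
    using act_flip_B[OF assms, of \<alpha> "l # u"] by (cases l; cases "fst l") auto
qed simp

lemma spread_walk_flip_B:
  assumes "bij t"
  shows "spread_walk \<alpha> L i (inv' t) (flip_B u) = spread_walk \<alpha> L i t u"
proof (induction u)
  case (Cons l u)
  then show ?case
    using act_flip_B[OF assms, of \<alpha> "l # u"] visited_flip_B[OF assms, of \<alpha> i u]
    by (cases l; cases "fst l") auto
qed simp

context
  fixes \<alpha> :: "'v \<Rightarrow> 'v" and W :: "'v set" and L :: nat
  assumes finW: "finite W" and \<alpha>: "\<alpha> permutes W"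
    and free: "\<And>x k. x \<in> W \<Longrightarrow> 0 < k \<Longrightarrow> k \<le> L \<Longrightarrow> (\<alpha> ^^ k) x \<noteq> x"
begin

lemma act_permutes: "t permutes W \<Longrightarrow> act \<alpha> t u permutes W"
  using \<alpha> by (intro word_perm_permutes) (auto split: gen.split)

lemma power_ne:
  assumes "x \<in> W" "y \<in> W" "0 < k" "k \<le> L" "(\<alpha> ^^ k) x = y \<or> (\<alpha> ^^ k) y = x"
  shows "x \<noteq> y"
  using assms free by metis

text \<open>After its last \<open>t\<close>-step the walk only follows \<open>\<alpha>\<close>, and for at most \<open>L\<close> steps; since the \<open>t\<close>-step left the
ball around the visited points, of which \<open>i\<close> is one, the walk cannot come back to \<open>i\<close>. Without any \<open>t\<close>-step,
freeness of \<open>\<alpha>\<close> is enough.\<close>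

lemma spread_walk_not_fixed:
  assumes t: "t permutes W" and i: "i \<in> W"
    and u: "reduced u" "u \<noteq> []" "length u \<le> L" and g: "spread_walk \<alpha> L i t u"
  shows "act \<alpha> t u i \<noteq> i"
proof -
  have W: "act \<alpha> t v i \<in> W" for v
    using permutes_in_image[OF act_permutes[OF t]] i by blast
  obtain k d v where v: "u = replicate k (Gen_A, d) @ v" "v = [] \<or> (\<exists>e w. v = (Gen_B, e) # w)"
    using reduced_leading_power[OF u(1)] by metis
  have k: "k \<le> L" using u(3) v(1) by simp
  note pow = act_power_A[OF permutes_bij[OF \<alpha>], of k t v i d, folded v(1)]
  show ?thesis
  proof (cases "v = []")
    case True
    then have "0 < k" using u(2) v(1) by auto
    then show ?thesis
      using power_ne[OF i W[of u] _ k] pow True by auto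
  next
    case False
    then obtain e w where ew: "v = (Gen_B, e) # w" using v(2) by blast
    have "act \<alpha> t v i \<notin> orbit_ball \<alpha> L (visited \<alpha> i t w)"
      using g unfolding v(1) spread_walk_power_A ew by simp
    then show ?thesis
      using pow k start_in_visited[of i \<alpha> t w] unfolding orbit_ball_def by auto
  qed
qed

text \<open>The value of \<open>t\<close> at the end point has not been revealed yet: the end point can only be the source of a used edge
if it is the source of the edge just traversed backwards, which reducedness of the word excludes.\<close>

lemma spread_walk_fresh:
  assumes t: "t permutes W" and i: "i \<in> W"
    and u: "reduced ((Gen_B, False) # u)" "length u \<le> L" and g: "spread_walk \<alpha> L i t u"
  shows "act \<alpha> t u i \<notin> fst ` used_edges \<alpha> i t u"
proof -
  have W: "act \<alpha> t v i \<in> W" for v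
    using permutes_in_image[OF act_permutes[OF t]] i by blast
  obtain k d v where v: "u = replicate k (Gen_A, d) @ v" "v = [] \<or> (\<exists>e w. v = (Gen_B, e) # w)"
    using reduced_leading_power[OF reduced_Cons[OF u(1)]] by metis
  have k: "k \<le> L" using u(2) v(1) by simp
  note pow = act_power_A[OF permutes_bij[OF \<alpha>], of k t v i d, folded v(1)]
  show ?thesis
  proof (cases "v = []")
    case True
    then show ?thesis unfolding v(1) used_edges_power_A by simp
  next
    case False
    then obtain e w where ew: "v = (Gen_B, e) # w" using v(2) by blast
    have "act \<alpha> t v i \<notin> orbit_ball \<alpha> L (visited \<alpha> i t w)"
      using g unfolding v(1) spread_walk_power_A ew by simp
    then have nv: "act \<alpha> t u i \<notin> visited \<alpha> i t w"
      using pow k unfolding orbit_ball_def by auto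
    have "act \<alpha> t u i \<noteq> act \<alpha> t v i" if e: "e"
    proof -
      have "k \<noteq> 0"
      proof
        assume "k = 0"
        then show False using u(1) e by (simp add: v(1) ew)
      qed
      then show ?thesis
        using power_ne[OF W[of v] W[of u] _ k] pow by auto
    qed
    moreover have "fst ` used_edges \<alpha> i t w \<subseteq> visited \<alpha> i t w"
      using used_edges_visited[of \<alpha> i t w] by auto
    ultimately show ?thesis
      using nv act_in_visited[of \<alpha> t w i]
      unfolding arg_cong[OF v(1), of "used_edges \<alpha> i t"] used_edges_power_A ew by auto
  qed
qed

text \<open>A switching argument. If the next \<open>t\<close>-step collides, at \<open>z\<close> say, then composing \<open>t\<close> with the transposition of
\<open>z\<close> and an arbitrary far point \<open>y\<close> yields a permutation with the same walk that sends its end point to \<open>y\<close>.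
Both \<open>t\<close> and \<open>y\<close> are recovered from the new permutation and \<open>z\<close>. There are at least
\<open>card W - 2 (L + 1)\<^sup>2\<close> choices of \<open>y\<close>, but at most \<open>2 (L + 1)\<^sup>2\<close> values of \<open>z\<close>, so collisions are rare.\<close>

lemma card_collision_step:
  assumes i: "i \<in> W" and u: "reduced ((Gen_B, False) # u)" "length u \<le> L"
  shows "card {t. t permutes W \<and> spread_walk \<alpha> L i t u \<and> t (act \<alpha> t u i) \<in> orbit_ball \<alpha> L (visited \<alpha> i t u)}
      * (card W - 2 * Suc L * Suc L) \<le> 2 * Suc L * Suc L * fact (card W)"
    (is "card ?B * (_ - ?K) \<le> _")
proof -
  let ?U = "\<lambda>t. orbit_ball \<alpha> L (visited \<alpha> i t u)"
  let ?P = "{t. t permutes W}"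
  let ?f = "\<lambda>(t, y). (transpose (t (act \<alpha> t u i)) y \<circ> t, t (act \<alpha> t u i))"
  have finP: "finite ?P" by (rule finite_permutations[OF finW])
  then have finB: "finite ?B" by (rule rev_finite_subset) auto
  have U: "finite (?U t)" "card (?U t) \<le> ?K" for t
  proof -
    note b = orbit_ball_card[OF permutes_bij[OF \<alpha>] finite_visited]
    show "finite (?U t)" by (rule b)
    have "card (?U t) \<le> 2 * Suc L * card (visited \<alpha> i t u)" by (rule b)
    also have "\<dots> \<le> ?K"
      using card_visited[of \<alpha> i t u] u(2) by (intro mult_le_mono) auto
    finally show "card (?U t) \<le> ?K" .
  qed
  have key: "act \<alpha> (transpose (t (act \<alpha> t u i)) y \<circ> t) u i = act \<alpha> t u i"
      "?U (transpose (t (act \<alpha> t u i)) y \<circ> t) = ?U t"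
      "transpose (t (act \<alpha> t u i)) y \<circ> t \<in> ?P"
    if t: "t \<in> ?B" and y: "y \<in> W - ?U t" for t y
  proof -
    let ?p = "act \<alpha> t u i"
    let ?t' = "transpose (t ?p) y \<circ> t"
    have tp: "t permutes W" using t by simp
    have "t ?p \<in> W"
      using permutes_in_image[OF act_permutes[OF tp]] permutes_in_image[OF tp] i by blast
    then show t': "?t' \<in> ?P"
      using y tp by (auto intro: permutes_compose permutes_swap_id)
    have "?t' x = z" if xz: "(x, z) \<in> used_edges \<alpha> i t u" for x z
    proof -
      have zt: "t x = z"
        using xz
      proof (induction u)
        case (Cons l u)
        then show ?case
          using tp permutes_inverses(1) by (cases l; cases "fst l") (fastforce split: if_splits)+
      qed simp
      have "x \<noteq> ?p"
        using spread_walk_fresh[OF tp i u] t xz by force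
      then have "t x \<noteq> t ?p" using permutes_inj[OF tp] by (metis injD)
      moreover have "z \<in> ?U t"
        using used_edges_visited[of \<alpha> i t u] xz unfolding orbit_ball_def by (auto intro!: bexI[of _ z] exI[of _ 0])
      then have "t x \<noteq> y" using y zt by auto
      ultimately show ?thesis using zt by (simp add: transpose_def)
    qed
    then have "act \<alpha> ?t' u i = act \<alpha> t u i \<and> visited \<alpha> i ?t' u = visited \<alpha> i t u"
      using t' tp by (intro act_agree) (auto dest: permutes_bij)
    then show "act \<alpha> ?t' u i = act \<alpha> t u i" "?U ?t' = ?U t" by auto
  qed
  have inj: "inj_on ?f (Sigma ?B (\<lambda>t. W - ?U t))"
  proof (rule inj_onI, clarify)
    fix t y s z
    assume t: "t permutes W" "spread_walk \<alpha> L i t u" "t (act \<alpha> t u i) \<in> ?U t" "y \<in> W" "y \<notin> ?U t"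
      and s: "s permutes W" "spread_walk \<alpha> L i s u" "s (act \<alpha> s u i) \<in> ?U s" "z \<in> W" "z \<notin> ?U s"
      and eq: "transpose (t (act \<alpha> t u i)) y \<circ> t = transpose (s (act \<alpha> s u i)) z \<circ> s"
        "t (act \<alpha> t u i) = s (act \<alpha> s u i)"
    have p: "act \<alpha> t u i = act \<alpha> s u i"
      using key(1)[of t y] key(1)[of s z] t s eq(1) by simp
    have "(transpose (t (act \<alpha> t u i)) y \<circ> t) (act \<alpha> t u i) = (transpose (s (act \<alpha> s u i)) z \<circ> s) (act \<alpha> s u i)"
      unfolding p by (rule fun_cong[OF eq(1)[unfolded p]])
    then have yz: "y = z" by simp
    have "transpose (t (act \<alpha> t u i)) y \<circ> (transpose (t (act \<alpha> t u i)) y \<circ> t)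
        = transpose (s (act \<alpha> s u i)) z \<circ> (transpose (s (act \<alpha> s u i)) z \<circ> s)"
      using eq yz by simp
    then have "t = s" by (simp add: fun_eq_iff)
    then show "t = s \<and> y = z" using yz by simp
  qed
  have sub: "?f ` Sigma ?B (\<lambda>t. W - ?U t) \<subseteq> Sigma ?P ?U"
  proof
    fix x assume "x \<in> ?f ` Sigma ?B (\<lambda>t. W - ?U t)"
    then obtain t y where ty: "t \<in> ?B" "y \<in> W - ?U t" and x: "x = ?f (t, y)" by blast
    show "x \<in> Sigma ?P ?U"
      using key(2,3)[OF ty] ty(1) by (simp add: x)
  qed
  have "card ?B * (card W - ?K) = (\<Sum>t\<in>?B. card W - ?K)" by simp
  also have "\<dots> \<le> (\<Sum>t\<in>?B. card (W - ?U t))"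
  proof (rule sum_mono)
    fix t
    show "card W - ?K \<le> card (W - ?U t)"
      using diff_card_le_card_Diff[OF U(1)[of t], of W] U(2)[of t] by simp
  qed
  also have "\<dots> = card (Sigma ?B (\<lambda>t. W - ?U t))"
    using finW finB by (simp add: card_SigmaI)
  also have "\<dots> \<le> card (Sigma ?P ?U)"
    using card_inj_on_le[OF inj sub] finP U(1) by blast
  also have "\<dots> = (\<Sum>t\<in>?P. card (?U t))"
    using finP U(1) by (simp add: card_SigmaI)
  also have "\<dots> \<le> (\<Sum>t\<in>?P. ?K)" by (rule sum_mono) (rule U)
  also have "\<dots> = ?K * fact (card W)"
    using card_permutations[OF HOL.refl finW] by simp
  finally show ?thesis .
qed

lemma card_collision_letter:
  assumes i: "i \<in> W" and u: "reduced ((Gen_B, e) # u)" "length u \<le> L"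
  shows "card {t. t permutes W \<and> spread_walk \<alpha> L i t u \<and> act \<alpha> t ((Gen_B, e) # u) i \<in> orbit_ball \<alpha> L (visited \<alpha> i t u)}
      * (card W - 2 * Suc L * Suc L) \<le> 2 * Suc L * Suc L * fact (card W)"
    (is "card ?B * _ \<le> _")
proof (cases e)
  case False
  then show ?thesis
    using card_collision_step[OF i, of u] u by simp
next
  case True
  let ?C = "{t. t permutes W \<and> spread_walk \<alpha> L i t (flip_B u) \<and>
    t (act \<alpha> t (flip_B u) i) \<in> orbit_ball \<alpha> L (visited \<alpha> i t (flip_B u))}"
  have "inv' ` ?B \<subseteq> ?C"
  proof clarify
    fix t assume t: "t permutes W" "spread_walk \<alpha> L i t u"
      "act \<alpha> t ((Gen_B, e) # u) i \<in> orbit_ball \<alpha> L (visited \<alpha> i t u)"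
    note b = permutes_bij[OF t(1)]
    show "inv' t permutes W \<and> spread_walk \<alpha> L i (inv' t) (flip_B u) \<and>
        inv' t (act \<alpha> (inv' t) (flip_B u) i) \<in> orbit_ball \<alpha> L (visited \<alpha> i (inv' t) (flip_B u))"
      using t True by (simp add: permutes_inv spread_walk_flip_B[OF b] act_flip_B[OF b] visited_flip_B[OF b])
  qed
  moreover have "inj_on inv' ?B"
  proof (rule inj_onI)
    fix t s assume "t \<in> ?B" "s \<in> ?B" and eq: "inv' t = inv' s"
    then have "bij t" "bij s" by (auto dest: permutes_bij)
    then show "t = s" using arg_cong[OF eq, of inv'] by (simp add: inv_inv_eq)
  qed
  moreover have "finite ?C"
    by (rule finite_subset[OF _ finite_permutations[OF finW]]) auto
  ultimately have "card ?B \<le> card ?C"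
    by (intro card_inj_on_le[of inv'])
  then have "card ?B * (card W - 2 * Suc L * Suc L) \<le> card ?C * (card W - 2 * Suc L * Suc L)"
    by (rule mult_le_mono1)
  also have "\<dots> \<le> 2 * Suc L * Suc L * fact (card W)"
    using reduced_flip_B[OF u(1)] True u(2)
    by (intro card_collision_step[OF i]) simp_all
  finally show ?thesis .
qed

lemma card_not_spread_walk:
  assumes i: "i \<in> W" and u: "reduced u" "length u \<le> L"
  shows "card {t. t permutes W \<and> \<not> spread_walk \<alpha> L i t u} * (card W - 2 * Suc L * Suc L)
      \<le> length u * (2 * Suc L * Suc L * fact (card W))"
    (is "_ * ?R \<le> _ * ?M")
  using u
proof (induction u)
  case Nil
  show ?case by simp
next
  case (Cons l u)
  have IH: "card {t. t permutes W \<and> \<not> spread_walk \<alpha> L i t u} * ?R \<le> length u * ?M"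
    by (rule Cons.IH[OF reduced_Cons[OF Cons.prems(1)]]) (use Cons.prems(2) in simp)
  obtain x e where l: "l = (x, e)" by force
  show ?case
  proof (cases x)
    case Gen_A
    then show ?thesis using IH by (simp add: l)
  next
    case Gen_B
    let ?B1 = "{t. t permutes W \<and> \<not> spread_walk \<alpha> L i t u}"
    let ?B2 = "{t. t permutes W \<and> spread_walk \<alpha> L i t u \<and>
      act \<alpha> t ((Gen_B, e) # u) i \<in> orbit_ball \<alpha> L (visited \<alpha> i t u)}"
    have fin: "finite ?B1" "finite ?B2"
      by (rule finite_subset[OF _ finite_permutations[OF finW]]; blast)+
    have "card {t. t permutes W \<and> \<not> spread_walk \<alpha> L i t (l # u)} \<le> card (?B1 \<union> ?B2)"
      using fin by (intro card_mono) (auto simp: l Gen_B)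
    also have "\<dots> \<le> card ?B1 + card ?B2" by (rule card_Un_le)
    finally have "card {t. t permutes W \<and> \<not> spread_walk \<alpha> L i t (l # u)} * ?R \<le> (card ?B1 + card ?B2) * ?R"
      by (rule mult_le_mono1)
    also have "\<dots> \<le> length u * ?M + ?M"
      unfolding add_mult_distrib
      using IH card_collision_letter[OF i, of e u] Cons.prems by (intro add_le_mono) (auto simp: l Gen_B)
    finally show ?thesis by simp
  qed
qed

text \<open>The bound does not depend on \<open>card W\<close> except through the number of permutations: on average a reduced word
has boundedly many fixed points.\<close>

lemma sum_fixed_points:
  assumes u: "reduced u" "u \<noteq> []" "length u \<le> L" and big: "4 * Suc L * Suc L \<le> card W"
  shows "(\<Sum>t | t permutes W. card {i \<in> W. act \<alpha> t u i = i}) \<le> 4 * L * Suc L * Suc L * fact (card W)"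
proof -
  let ?P = "{t. t permutes W}"
  let ?K = "2 * Suc L * Suc L"
  let ?R = "card W - ?K"
  have finP: "finite ?P" by (rule finite_permutations[OF finW])
  have *: "card {t \<in> ?P. act \<alpha> t u i = i} * ?R \<le> L * (?K * fact (card W))" if i: "i \<in> W" for i
  proof -
    have "card {t \<in> ?P. act \<alpha> t u i = i} \<le> card {t. t permutes W \<and> \<not> spread_walk \<alpha> L i t u}"
      using spread_walk_not_fixed[OF _ i u] finP by (intro card_mono) auto
    then have "card {t \<in> ?P. act \<alpha> t u i = i} * ?R \<le> card {t. t permutes W \<and> \<not> spread_walk \<alpha> L i t u} * ?R"
      by (rule mult_le_mono1)
    also have "\<dots> \<le> length u * (?K * fact (card W))"
      by (rule card_not_spread_walk[OF i u(1,3)])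
    also have "\<dots> \<le> L * (?K * fact (card W))"
      using u(3) by (rule mult_le_mono1)
    finally show ?thesis .
  qed
  have "(\<Sum>t\<in>?P. card {i \<in> W. act \<alpha> t u i = i}) = (\<Sum>t\<in>?P. \<Sum>i\<in>W. if act \<alpha> t u i = i then 1 else 0)"
    using finW by (simp add: sum.If_cases Int_def)
  also have "\<dots> = (\<Sum>i\<in>W. \<Sum>t\<in>?P. if act \<alpha> t u i = i then 1 else 0)"
    by (rule sum.swap)
  also have "\<dots> = (\<Sum>i\<in>W. card {t \<in> ?P. act \<alpha> t u i = i})"
    using finP by (simp add: sum.If_cases Int_def)
  finally have eq: "(\<Sum>t\<in>?P. card {i \<in> W. act \<alpha> t u i = i}) = (\<Sum>i\<in>W. card {t \<in> ?P. act \<alpha> t u i = i})" .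
  have "(\<Sum>t\<in>?P. card {i \<in> W. act \<alpha> t u i = i}) * ?R = (\<Sum>i\<in>W. card {t \<in> ?P. act \<alpha> t u i = i} * ?R)"
    unfolding eq by (rule sum_distrib_right)
  also have "\<dots> \<le> (\<Sum>i\<in>W. L * (?K * fact (card W)))"
    by (rule sum_mono) (rule *)
  also have "\<dots> = card W * (L * (?K * fact (card W)))" by simp
  also have "\<dots> \<le> (2 * ?R) * (L * (?K * fact (card W)))"
  proof (rule mult_le_mono1)
    have "c \<le> 2 * (c - k)" if "2 * k \<le> c" for c k :: nat using that by linarith
    moreover have "2 * ?K \<le> card W" using big by (simp add: algebra_simps)
    ultimately show "card W \<le> 2 * ?R" .
  qed
  also have "\<dots> = (4 * L * Suc L * Suc L * fact (card W)) * ?R"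
    by (simp only: ac_simps)
  finally have "(\<Sum>t\<in>?P. card {i \<in> W. act \<alpha> t u i = i}) * ?R \<le> (4 * L * Suc L * Suc L * fact (card W)) * ?R" .
  moreover have "0 < ?R" using big by (simp add: algebra_simps)
  ultimately show ?thesis by (rule mult_right_le_imp_le)
qed

end

section \<open>Permutations that carry a forbidden labelling\<close>

text \<open>Consider the cyclic shift of \<open>{..<N}\<close>, where \<open>N = 192 M\<close>. For at least half of all permutations \<open>t\<close> there are no
two sets \<open>X\<close>, \<open>Y\<close> that both alternate along the cycle with at most \<open>M\<close> exceptions, such that \<open>t\<close> maps \<open>X\<close> to \<open>Y\<close>
up to \<open>M\<close> exceptions.\<close>

lemma ex_permutes_image:
  assumes W: "finite W" and X: "X \<subseteq> W" "Y \<subseteq> W" "card X = card Y"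
  shows "\<exists>\<sigma>. \<sigma> permutes W \<and> \<sigma> ` X = Y"
proof -
  have fin: "finite X" "finite Y" using W X finite_subset by auto
  obtain f where f: "bij_betw f X Y"
    using finite_same_card_bij[OF fin X(3)] by blast
  have "card (W - X) = card (W - Y)"
    using X fin by (simp add: card_Diff_subset)
  then obtain g where g: "bij_betw g (W - X) (W - Y)"
    using finite_same_card_bij[of "W - X" "W - Y"] W by blast
  define \<sigma> where "\<sigma> x = (if x \<in> X then f x else if x \<in> W then g x else x)" for x
  have "bij_betw \<sigma> X Y" using f by (rule bij_betw_cong[THEN iffD1, rotated]) (simp add: \<sigma>_def)
  moreover have "bij_betw \<sigma> (W - X) (W - Y)"
    using g by (rule bij_betw_cong[THEN iffD1, rotated]) (simp add: \<sigma>_def)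
  ultimately have "bij_betw \<sigma> (X \<union> (W - X)) (Y \<union> (W - Y))"
    by (rule bij_betw_combine) auto
  then have "bij_betw \<sigma> W W" using X by (simp add: Un_absorb1)
  then have "\<sigma> permutes W"
    by (rule bij_imp_permutes) (use X in \<open>auto simp: \<sigma>_def\<close>)
  then show ?thesis
    using \<open>bij_betw \<sigma> X Y\<close> by (auto simp: bij_betw_def)
qed

text \<open>All sets \<open>X'\<close> with as many elements as \<open>X\<close> are images of \<open>Y\<close> under equally many permutations, and the
permutations for different \<open>X'\<close> are different.\<close>

lemma card_permutes_image:
  assumes W: "finite W" and X: "X \<subseteq> W"
  shows "card {t. t permutes W \<and> t ` Y = X} * (card W choose card X) \<le> fact (card W)"
proof -
  let ?T = "{t. t permutes W \<and> t ` Y = X}"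
  let ?S = "{X'. X' \<subseteq> W \<and> card X' = card X}"
  have "\<exists>\<sigma>. \<sigma> permutes W \<and> \<sigma> ` X = X'" if "X' \<in> ?S" for X'
    using ex_permutes_image[OF W X, of X'] that by auto
  then obtain \<sigma> where \<sigma>: "\<And>X'. X' \<in> ?S \<Longrightarrow> \<sigma> X' permutes W \<and> \<sigma> X' ` X = X'"
    by metis
  let ?f = "\<lambda>(t, X'). \<sigma> X' \<circ> t"
  have "inj_on ?f (?T \<times> ?S)"
  proof (rule inj_onI)
    fix x y assume xy: "x \<in> ?T \<times> ?S" "y \<in> ?T \<times> ?S" and eq: "?f x = ?f y"
    obtain t X1 s X2 where x: "x = (t, X1)" and y: "y = (s, X2)" by force
    have t: "t ` Y = X" "X1 \<in> ?S" and s: "s ` Y = X" "X2 \<in> ?S"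
      using xy by (auto simp: x y)
    have e: "\<sigma> X1 \<circ> t = \<sigma> X2 \<circ> s" using eq by (simp add: x y)
    then have "\<sigma> X1 ` t ` Y = \<sigma> X2 ` s ` Y" by (simp add: image_comp)
    then have X: "X1 = X2" using \<sigma>[OF t(2)] \<sigma>[OF s(2)] t(1) s(1) by simp
    have "inj (\<sigma> X1)" using \<sigma>[OF t(2)] by (blast intro: permutes_inj)
    then have "t = s" using e X by (auto simp: fun_eq_iff inj_def)
    then show "x = y" using X by (simp add: x y)
  qed
  moreover have "?f ` (?T \<times> ?S) \<subseteq> {t. t permutes W}"
    using \<sigma> by (auto intro!: permutes_compose simp del: comp_apply)
  ultimately have "card (?T \<times> ?S) \<le> card {t. t permutes W}"
    using card_inj_on_le finite_permutations[OF W] by blast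
  then show ?thesis
    using n_subsets[OF W, of "card X"] card_permutations[OF HOL.refl W]
    by (simp add: card_cartesian_product)
qed

lemma card_small_subsets:
  assumes W: "finite W" and K: "K \<le> card W" and x: "0 < x"
  shows "card {D. D \<subseteq> W \<and> card D \<le> K} * x ^ (card W - K) \<le> (x + 1) ^ card W"
proof -
  let ?N = "card W"
  have "{D. D \<subseteq> W \<and> card D \<le> K} = (\<Union>k\<le>K. {D. D \<subseteq> W \<and> card D = k})" by auto
  then have "card {D. D \<subseteq> W \<and> card D \<le> K} \<le> (\<Sum>k\<le>K. ?N choose k)"
    using card_UN_le[of "{..K}" "\<lambda>k. {D. D \<subseteq> W \<and> card D = k}"] n_subsets[OF W] by simp
  then have "card {D. D \<subseteq> W \<and> card D \<le> K} * x ^ (?N - K) \<le> (\<Sum>k\<le>K. ?N choose k) * x ^ (?N - K)"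
    by (rule mult_le_mono1)
  also have "\<dots> = (\<Sum>k\<le>K. (?N choose k) * x ^ (?N - K))"
    by (rule sum_distrib_right)
  also have "\<dots> \<le> (\<Sum>k\<le>K. (?N choose k) * x ^ (?N - k))"
    using x K by (intro sum_mono mult_le_mono2 power_increasing) auto
  also have "\<dots> \<le> (\<Sum>k\<le>?N. (?N choose k) * x ^ (?N - k))"
    using K by (intro sum_mono2) auto
  also have "\<dots> = (x + 1) ^ ?N"
    using binomial[of 1 x ?N] by (simp add: add.commute)
  finally show ?thesis .
qed

text \<open>With \<open>x = 32\<close> in the previous bound the exponent \<open>17 M\<close> is so small that three factors of this size nonalternating below
\<open>2 ^ (64 * M)\<close>, the lower bound for a central binomial coefficient that is used below.\<close>

lemma card_very_small_subsets:
  assumes "finite W" "card W = 192 * M"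
  shows "card {D. D \<subseteq> W \<and> card D \<le> M} \<le> 2 ^ (17 * M)" (is "?S \<le> _")
proof -
  have "?S * 32 ^ (191 * M) \<le> 33 ^ (192 * M)"
    using card_small_subsets[OF assms(1), of M 32] assms(2) by simp
  also have "(33::nat) ^ (192 * M) = (33 ^ 192) ^ M" by (simp add: power_mult)
  also have "\<dots> \<le> (2 ^ 972) ^ M"
    by (rule power_mono) simp_all
  also have "\<dots> = 2 ^ (17 * M) * (2 ^ 5) ^ (191 * M)"
    unfolding power_mult[symmetric] power_add[symmetric] by (simp add: algebra_simps)
  finally have "?S * 32 ^ (191 * M) \<le> 2 ^ (17 * M) * 32 ^ (191 * M)" by simp
  then show ?thesis by simp
qed

definition shift :: "nat \<Rightarrow> nat \<Rightarrow> nat" where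
  "shift N w = (if w < N then Suc w mod N else w)"

definition nonalternating :: "nat \<Rightarrow> nat set \<Rightarrow> nat set" where
  "nonalternating N X = {w. w < N \<and> (shift N w \<in> X \<longleftrightarrow> w \<in> X)}"

lemma shift_funpow: "w < N \<Longrightarrow> (shift N ^^ k) w = (w + k) mod N"
  by (induction k) (auto simp: shift_def mod_Suc_eq)

lemma shift_permutes: "shift N permutes {..<N}"
proof (rule bij_imp_permutes)
  have "inj_on (shift N) {..<N}"
    by (rule inj_onI) (auto simp: shift_def mod_Suc split: if_splits)
  moreover have "shift N ` {..<N} \<subseteq> {..<N}" by (auto simp: shift_def)
  ultimately show "bij_betw (shift N) {..<N} {..<N}"
    by (simp add: bij_betw_def endo_inj_surj)
qed (auto simp: shift_def)

lemma shift_free: "w < N \<Longrightarrow> 0 < k \<Longrightarrow> k < N \<Longrightarrow> (shift N ^^ k) w \<noteq> w"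
proof
  assume w: "w < N" and k: "0 < k" "k < N" and "(shift N ^^ k) w = w"
  then have "(w + k) mod N = w" by (simp add: shift_funpow)
  then show False using w k by (cases "w + k < N") (simp_all add: le_mod_geq)
qed

text \<open>Along a single cycle a set is determined by whether it contains \<open>0\<close> and by the points where it fails to
alternate. This is why the cycle has few almost alternating sets, while it has \<open>2 ^ N\<close> sets altogether.\<close>

lemma card_near_alternating:
  "card {X. X \<subseteq> {..<N} \<and> card (nonalternating N X) \<le> K} \<le> 2 * card {D. D \<subseteq> {..<N} \<and> card D \<le> K}"
proof -
  let ?A = "{X. X \<subseteq> {..<N} \<and> card (nonalternating N X) \<le> K}" and ?B = "{D. D \<subseteq> {..<N} \<and> card D \<le> K}"
  let ?f = "\<lambda>X. (0 \<in> X, nonalternating N X)"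
  have "inj_on ?f ?A"
  proof (rule inj_onI)
    fix X Y assume X: "X \<in> ?A" "Y \<in> ?A" and eq: "?f X = ?f Y"
    have "w \<in> X \<longleftrightarrow> w \<in> Y" if "w < N" for w
      using that
    proof (induction w)
      case 0
      show ?case using eq by simp
    next
      case (Suc w)
      then have c: "shift N w = Suc w" by (simp add: shift_def)
      have "w \<in> nonalternating N X \<longleftrightarrow> w \<in> nonalternating N Y" using eq by simp
      then show ?case using Suc c by (auto simp: nonalternating_def)
    qed
    then show "X = Y" using X by auto
  qed
  moreover have "?f ` ?A \<subseteq> UNIV \<times> ?B"
    by (auto simp: nonalternating_def)
  moreover have "finite ((UNIV :: bool set) \<times> ?B)" by simp
  ultimately have "card ?A \<le> card ((UNIV :: bool set) \<times> ?B)"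
    using card_inj_on_le by blast
  then show ?thesis by (simp add: card_cartesian_product)
qed

text \<open>Away from the exceptions the shift maps \<open>X\<close> into its complement and conversely.\<close>

lemma near_alternating_balanced:
  assumes X: "X \<subseteq> {..<N}"
  shows "2 * card X \<le> N + card (nonalternating N X)" "N \<le> 2 * card X + card (nonalternating N X)"
proof -
  have fin: "finite X" "finite (nonalternating N X)"
    using X finite_subset by (auto simp: nonalternating_def)
  have inj: "inj_on (shift N) S" for S
    using permutes_inj_on[OF shift_permutes] by blast
  have lt: "shift N w < N" if "w < N" for w using that by (auto simp: shift_def)
  have c: "card ({..<N} - X) = N - card X" "card X \<le> N"
    using X fin(1) card_mono[OF _ X] by (auto simp: card_Diff_subset)
  have "card (X - nonalternating N X) \<le> card ({..<N} - X)"
    using X lt by (intro card_inj_on_le[OF inj]) (auto simp: nonalternating_def)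
  moreover have "card X - card (nonalternating N X) \<le> card (X - nonalternating N X)"
    by (rule diff_card_le_card_Diff[OF fin(2)])
  ultimately show "2 * card X \<le> N + card (nonalternating N X)" using c by linarith
  have "card ({..<N} - X - nonalternating N X) \<le> card X"
    using fin lt by (intro card_inj_on_le[OF inj]) (auto simp: nonalternating_def)
  moreover have "card ({..<N} - X) - card (nonalternating N X) \<le> card ({..<N} - X - nonalternating N X)"
    by (rule diff_card_le_card_Diff[OF fin(2)])
  ultimately show "N \<le> 2 * card X + card (nonalternating N X)" using c by linarith
qed

lemma binomial_ge_power2:
  assumes "0 < m" "2 * m \<le> n"
  shows "2 ^ m \<le> n choose m"
proof -
  have "(2::real) ^ m \<le> (real n / real m) ^ m"
  proof (rule power_mono)
    have "2 * real m \<le> real n" using assms(2) by linarith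
    then show "2 \<le> real n / real m" using assms(1) by (simp add: pos_le_divide_eq)
  qed simp
  also have "\<dots> \<le> real (n choose m)"
    by (rule binomial_ge_n_over_k_pow_k) (use assms in simp)
  finally show ?thesis by (metis of_nat_le_iff of_nat_numeral of_nat_power)
qed

lemma central_binomial_ge:
  assumes "0 < k" "k \<le> m" "k + m \<le> n"
  shows "2 ^ k \<le> n choose m"
proof (cases "2 * m \<le> n")
  case True
  have "(2::nat) ^ k \<le> 2 ^ m" using assms by (intro power_increasing) auto
  also have "\<dots> \<le> n choose m" using assms True by (intro binomial_ge_power2) auto
  finally show ?thesis .
next
  case False
  have "(2::nat) ^ k \<le> 2 ^ (n - m)" using assms by (intro power_increasing) auto
  also have "\<dots> \<le> n choose (n - m)" using assms False by (intro binomial_ge_power2) auto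
  also have "\<dots> = n choose m" using assms by (intro binomial_symmetric[symmetric]) auto
  finally show ?thesis .
qed

definition bad_perms :: "nat \<Rightarrow> (nat \<Rightarrow> nat) set" where
  "bad_perms M = {t. t permutes {..<192 * M} \<and>
     (\<exists>X Y. X \<subseteq> {..<192 * M} \<and> Y \<subseteq> {..<192 * M} \<and>
        card (nonalternating (192 * M) X) \<le> M \<and> card (nonalternating (192 * M) Y) \<le> M \<and>
        card {w. w < 192 * M \<and> (t w \<in> Y) \<noteq> (w \<in> X)} \<le> M)}"

text \<open>A union bound over \<open>X\<close>, \<open>Y\<close> and the exceptional set \<open>D\<close>, for each of which there are at most about
\<open>2 ^ (17 * M)\<close> choices. Each choice prescribes the image of one set of size about \<open>N / 2\<close>, which holds for a
proportion of at most \<open>2 ^ - (64 * M) = 2 ^ - (N / 3)\<close> of the permutations. The ratio \<open>192\<close> of \<open>N\<close> to \<open>M\<close> is large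
enough for the second effect to win.\<close>

lemma card_bad_perms:
  assumes M: "0 < M"
  shows "2 * card (bad_perms M) \<le> fact (192 * M)"
proof -
  define N where "N = 192 * M"
  let ?W = "{..<N}"
  let ?A = "{X. X \<subseteq> ?W \<and> card (nonalternating N X) \<le> M}" and ?B = "{D. D \<subseteq> ?W \<and> card D \<le> M}"
  let ?T = "\<lambda>X D Y. {t. t permutes ?W \<and> t ` sym_diff X D = Y}"
  have B: "card ?B \<le> 2 ^ (17 * M)"
    by (rule card_very_small_subsets) (simp_all add: N_def)
  have A: "card ?A \<le> 2 * 2 ^ (17 * M)"
    using card_near_alternating[of N M] B by linarith
  have fin: "finite ?A" "finite ?B" by simp_all
  have finT: "finite (?T X D Y)" for X D Y
    by (rule finite_subset[OF _ finite_permutations[of ?W]]) auto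
  have "bad_perms M \<subseteq> (\<Union>(X, D, Y) \<in> ?A \<times> ?B \<times> ?A. ?T X D Y)"
  proof
    fix t assume "t \<in> bad_perms M"
    then obtain X Y where t: "t permutes ?W" and XY: "X \<in> ?A" "Y \<in> ?A"
      and D: "card {w. w < N \<and> (t w \<in> Y) \<noteq> (w \<in> X)} \<le> M" (is "card ?D \<le> M")
      unfolding bad_perms_def N_def by blast
    have "sym_diff X ?D = {w. w < N \<and> t w \<in> Y}" using XY by auto
    moreover have "t ` {w. w < N \<and> t w \<in> Y} = Y"
    proof
      show "Y \<subseteq> t ` {w. w < N \<and> t w \<in> Y}"
      proof
        fix y assume y: "y \<in> Y"
        then have "inv' t y < N" "t (inv' t y) = y"
          using XY permutes_in_image[OF permutes_inv[OF t], of y] permutes_inverses[OF t] by auto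
        then show "y \<in> t ` {w. w < N \<and> t w \<in> Y}" using y by force
      qed
    qed auto
    ultimately have "t \<in> ?T X ?D Y" using t by simp
    moreover have "?D \<in> ?B" using D by auto
    ultimately show "t \<in> (\<Union>(X, D, Y) \<in> ?A \<times> ?B \<times> ?A. ?T X D Y)"
      using XY by (intro UN_I[of "(X, ?D, Y)"]) auto
  qed
  then have "card (bad_perms M) \<le> card (\<Union>(X, D, Y) \<in> ?A \<times> ?B \<times> ?A. ?T X D Y)"
    using fin finT by (intro card_mono) auto
  also have "\<dots> \<le> (\<Sum>p \<in> ?A \<times> ?B \<times> ?A. card (case p of (X, D, Y) \<Rightarrow> ?T X D Y))"
    using fin by (intro card_UN_le) auto
  finally have "card (bad_perms M) * 2 ^ (64 * M)
      \<le> (\<Sum>p \<in> ?A \<times> ?B \<times> ?A. card (case p of (X, D, Y) \<Rightarrow> ?T X D Y)) * 2 ^ (64 * M)"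
    by (rule mult_le_mono1)
  also have "\<dots> = (\<Sum>p \<in> ?A \<times> ?B \<times> ?A. card (case p of (X, D, Y) \<Rightarrow> ?T X D Y) * 2 ^ (64 * M))"
    by (rule sum_distrib_right)
  also have "\<dots> \<le> (\<Sum>p \<in> ?A \<times> ?B \<times> ?A. fact N)"
  proof (rule sum_mono)
    fix p assume "p \<in> ?A \<times> ?B \<times> ?A"
    then obtain X D Y where p: "p = (X, D, Y)" and Y: "Y \<subseteq> ?W" "card (nonalternating N Y) \<le> M" by auto
    have "2 ^ (64 * M) \<le> N choose card Y"
      using near_alternating_balanced[OF Y(1)] Y(2) M by (intro central_binomial_ge) (auto simp: N_def)
    then have "card (?T X D Y) * 2 ^ (64 * M) \<le> card (?T X D Y) * (N choose card Y)"
      by (rule mult_le_mono2)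
    also have "\<dots> \<le> fact N"
      using card_permutes_image[of ?W Y "sym_diff X D"] Y(1) by simp
    finally show "card (case p of (X, D, Y) \<Rightarrow> ?T X D Y) * 2 ^ (64 * M) \<le> fact N" by (simp add: p)
  qed
  also have "\<dots> = card ?A * card ?B * card ?A * fact N"
    by (simp add: card_cartesian_product algebra_simps)
  also have "\<dots> \<le> (2 * 2 ^ (17 * M)) * 2 ^ (17 * M) * (2 * 2 ^ (17 * M)) * fact N"
    by (intro mult_le_mono A B order.refl)
  also have "\<dots> = 2 ^ (51 * M + 2) * fact N"
  proof -
    have "17 * M + 17 * M + 17 * M = 51 * M" by simp
    then have "(2::nat) ^ (51 * M) = 2 ^ (17 * M) * 2 ^ (17 * M) * 2 ^ (17 * M)"
      by (metis power_add)
    then show ?thesis by (simp add: algebra_simps)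
  qed
  finally have main: "card (bad_perms M) * 2 ^ (64 * M) \<le> 2 ^ (51 * M + 2) * fact N" .
  have "2 ^ (51 * M + 2) * (2 * card (bad_perms M)) = card (bad_perms M) * 2 ^ (51 * M + 3)"
    by (simp add: power_add)
  also have "\<dots> \<le> card (bad_perms M) * 2 ^ (64 * M)"
    using M by (intro mult_le_mono2 power_increasing) auto
  also have "\<dots> \<le> 2 ^ (51 * M + 2) * fact N" by (rule main)
  finally show ?thesis unfolding N_def by simp
qed

section \<open>Finite models\<close>

lemma ex_balanced_perm:
  "\<exists>M t. M > k \<and> t permutes {..<192 * M} \<and> t \<notin> bad_perms M \<and>
     (\<forall>u. reduced u \<and> u \<noteq> [] \<and> length u \<le> k \<longrightarrow>
        Suc k * card {i \<in> {..<192 * M}. act (shift (192 * M)) t u i = i} \<le> 192 * M)"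
proof -
  define Q where "Q = {u :: gen word. reduced u \<and> u \<noteq> [] \<and> length u \<le> k}"
  define C where "C = card Q * (4 * k * Suc k * Suc k)"
  define M where "M = Suc (4 * Suc k * Suc k + Suc k * (2 * C))"
  define N where "N = 192 * M"
  define T where "T t = (\<Sum>u\<in>Q. card {i \<in> {..<N}. act (shift N) t u i = i})" for t
  let ?P = "{t. t permutes {..<N}}"
  have M: "k < M" "4 * Suc k * Suc k \<le> N" "Suc k * (2 * C) \<le> N" "k < N"
    by (simp_all add: M_def N_def)
  have "finite (UNIV :: gen set)"
    by (rule finite_subset[of _ "{Gen_A, Gen_B}"]) (auto intro: gen.exhaust)
  then have "finite {u :: gen word. set u \<subseteq> UNIV \<and> length u \<le> k}"
    by (intro finite_lists_length_le) (simp add: finite_prod)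
  then have finQ: "finite Q"
    by (rule rev_finite_subset) (auto simp: Q_def)
  have finP: "finite ?P" by (rule finite_permutations) simp
  have cardP: "card ?P = fact N" by (rule card_permutations) simp_all
  have "(\<Sum>t\<in>?P. T t) = (\<Sum>u\<in>Q. \<Sum>t\<in>?P. card {i \<in> {..<N}. act (shift N) t u i = i})"
    unfolding T_def by (rule sum.swap)
  also have "\<dots> \<le> (\<Sum>u\<in>Q. 4 * k * Suc k * Suc k * fact N)"
  proof (rule sum_mono)
    fix u assume "u \<in> Q"
    then show "(\<Sum>t\<in>?P. card {i \<in> {..<N}. act (shift N) t u i = i}) \<le> 4 * k * Suc k * Suc k * fact N"
      using sum_fixed_points[of "{..<N}" "shift N" k u] shift_permutes[of N] shift_free[of _ N] M(2,4)
      by (simp add: Q_def del: mult_Suc mult_Suc_right)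
  qed
  also have "\<dots> = C * fact N" by (simp add: C_def)
  finally have sumT: "(\<Sum>t\<in>?P. T t) \<le> C * fact N" .
  have sub: "bad_perms M \<subseteq> ?P" by (auto simp: bad_perms_def N_def)
  \<comment> \<open>The mean of \<open>T\<close> is at most \<open>C\<close>, and at least half of all permutations are not bad, so \<open>T\<close> cannot exceed \<open>2 C\<close> on all of these.\<close>
  have "\<exists>t\<in>?P - bad_perms M. T t \<le> 2 * C"
  proof (rule ccontr)
    assume "\<not> ?thesis"
    then have "Suc (2 * C) \<le> T t" if "t \<in> ?P - bad_perms M" for t
      using that by force
    then have "(\<Sum>t\<in>?P - bad_perms M. Suc (2 * C)) \<le> (\<Sum>t\<in>?P - bad_perms M. T t)"
      by (rule sum_mono)
    also have "\<dots> \<le> (\<Sum>t\<in>?P. T t)"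
      using finP by (intro sum_mono2) auto
    finally have "card (?P - bad_perms M) * Suc (2 * C) \<le> C * fact N"
      using sumT by simp
    moreover have "fact N \<le> 2 * card (?P - bad_perms M)"
      using card_bad_perms[of M] M(1) card_Diff_subset[OF finite_subset[OF sub finP] sub] cardP
      by (simp add: N_def)
    ultimately have "fact N * Suc (2 * C) \<le> 2 * (C * fact N)"
      using mult_le_mono1[of "fact N" "2 * card (?P - bad_perms M)" "Suc (2 * C)"] by linarith
    then show False by (simp add: algebra_simps)
  qed
  then obtain t where t: "t permutes {..<N}" "t \<notin> bad_perms M" "T t \<le> 2 * C" by blast
  have "Suc k * card {i \<in> {..<N}. act (shift N) t u i = i} \<le> N" if "u \<in> Q" for u
  proof -
    have "card {i \<in> {..<N}. act (shift N) t u i = i} \<le> T t"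
      unfolding T_def using finQ that by (intro member_le_sum) auto
    then have "Suc k * card {i \<in> {..<N}. act (shift N) t u i = i} \<le> Suc k * (2 * C)"
      using t(3) by (intro mult_le_mono2) linarith
    then show ?thesis using M(3) by linarith
  qed
  then show ?thesis
    using t M(1) unfolding Q_def N_def by blast
qed

text \<open>The map \<open>(w, e) \<mapsto> (p w, e)\<close> on two copies of \<open>{..<N}\<close>, or \<open>(w, e) \<mapsto> (p w, 1 - e)\<close> if \<open>b\<close> holds, where \<open>(w, e)\<close> is
encoded as \<open>w + N e + 1\<close>.\<close>

definition double_lift :: "nat \<Rightarrow> bool \<Rightarrow> (nat \<Rightarrow> nat) \<Rightarrow> nat \<Rightarrow> nat" where
  "double_lift N b p i =
     (if i \<in> {1..2 * N} then Suc (p ((i - 1) mod N) + N * (if b then 1 - (i - 1) div N else (i - 1) div N))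
      else i)"

lemma double_side:
  assumes "i \<in> {1..2 * N}"
  shows "(i - 1) div N < (2 :: nat)"
proof (rule less_mult_imp_div_less)
  show "i - 1 < 2 * N" using assms by auto
qed

lemma double_lift:
  assumes p: "p permutes {..<N}" and i: "i \<in> {1..2 * N}"
  shows "double_lift N b p i \<in> {1..2 * N}"
    "(double_lift N b p i - 1) mod N = p ((i - 1) mod N)"
    "(double_lift N b p i - 1) div N = (if b then 1 - (i - 1) div N else (i - 1) div N)"
proof -
  have N: "N > 0" using i by (cases N) auto
  have d: "(i - 1) div N \<le> 1"
    using double_side[OF i] by simp
  have "p ((i - 1) mod N) < N"
    using permutes_in_image[OF p, of "(i - 1) mod N"] N by simp
  moreover define x e where "x = p ((i - 1) mod N)" and "e = (if b then 1 - (i - 1) div N else (i - 1) div N)"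
  ultimately have x: "x < N" and e: "e = 0 \<or> e = 1"
    using d by (auto split: if_splits)
  have eq: "double_lift N b p i = Suc (x + N * e)"
    using i by (simp add: double_lift_def x_def e_def)
  show "double_lift N b p i \<in> {1..2 * N}"
    unfolding eq using x e by auto
  have "(x + N * e) mod N = x" "(x + N * e) div N = e"
    using x by auto
  then show "(double_lift N b p i - 1) mod N = p ((i - 1) mod N)"
    "(double_lift N b p i - 1) div N = (if b then 1 - (i - 1) div N else (i - 1) div N)"
    unfolding eq x_def[symmetric] e_def[symmetric] by simp_all
qed

lemma double_coordinates:
  fixes i j :: nat
  assumes "i \<in> {1..n}" "j \<in> {1..n}" "(i - 1) mod N = (j - 1) mod N" "(i - 1) div N = (j - 1) div N"
  shows "i = j"
proof -
  have "i - 1 = j - 1" using assms(3,4) by (metis div_mult_mod_eq)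
  then show ?thesis using assms(1,2) by auto
qed

lemma double_lift_permutes:
  assumes p: "p permutes {..<N}"
  shows "double_lift N b p permutes {1..2 * N}"
proof (rule bij_imp_permutes)
  have "inj_on (double_lift N b p) {1..2 * N}"
  proof (rule inj_onI)
    fix i j assume ij: "i \<in> {1..2 * N}" "j \<in> {1..2 * N}" and eq: "double_lift N b p i = double_lift N b p j"
    have d: "(i - 1) div N \<le> 1" "(j - 1) div N \<le> 1"
      using double_side[OF ij(1)] double_side[OF ij(2)] by simp_all
    show "i = j"
    proof (rule double_coordinates[OF ij])
      show "(i - 1) mod N = (j - 1) mod N"
        using double_lift(2)[OF p ij(1), of b] double_lift(2)[OF p ij(2), of b] eq permutes_inj[OF p]
        by (metis injD)
      show "(i - 1) div N = (j - 1) div N"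
      proof -
        have "(if b then 1 - (i - 1) div N else (i - 1) div N) = (if b then 1 - (j - 1) div N else (j - 1) div N)"
          unfolding double_lift(3)[OF p ij(1), of b, symmetric] double_lift(3)[OF p ij(2), of b, symmetric] eq ..
        then show ?thesis using d by (cases b; simp only: if_True if_False; linarith)
      qed
    qed
  qed
  moreover have "double_lift N b p ` {1..2 * N} \<subseteq> {1..2 * N}"
    using double_lift(1)[OF p] by blast
  ultimately show "bij_betw (double_lift N b p) {1..2 * N} {1..2 * N}"
    by (simp add: bij_betw_def endo_inj_surj)
qed (auto simp: double_lift_def)

lemma act_double_lift:
  assumes \<alpha>: "\<alpha> permutes {..<N}" and t: "t permutes {..<N}" and i: "i \<in> {1..2 * N}"
  shows "act (double_lift N d \<alpha>) (double_lift N e t) u i \<in> {1..2 * N} \<and>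
    (act (double_lift N d \<alpha>) (double_lift N e t) u i - 1) mod N = act \<alpha> t u ((i - 1) mod N)"
proof (induction u)
  case Nil
  show ?case using i by simp
next
  case (Cons l u)
  have inv: "inv' (double_lift N b p) j \<in> {1..2 * N} \<and>
      (inv' (double_lift N b p) j - 1) mod N = inv' p ((j - 1) mod N)"
    if p: "p permutes {..<N}" and j: "j \<in> {1..2 * N}" for b p j
  proof
    let ?q = "double_lift N b p"
    have q: "?q permutes {1..2 * N}" by (rule double_lift_permutes[OF p])
    show *: "inv' ?q j \<in> {1..2 * N}"
      using permutes_in_image[OF permutes_inv[OF q]] j by blast
    have "(j - 1) mod N = p ((inv' ?q j - 1) mod N)"
      using double_lift(2)[OF p *, of b] permutes_inverses(1)[OF q, of j] by simp
    then show "(inv' ?q j - 1) mod N = inv' p ((j - 1) mod N)"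
      using permutes_inverses(2)[OF p] by simp
  qed
  show ?case
    using Cons double_lift(1,2)[OF \<alpha>] double_lift(1,2)[OF t] inv[OF \<alpha>] inv[OF t]
    by (cases l; cases "fst l") (auto simp del: atLeastAtMost_iff)
qed

text \<open>How far \<open>f\<close> is from being a labelling that \<open>a\<close> flips and \<open>c\<close> preserves.\<close>

definition defect :: "nat \<Rightarrow> (nat \<Rightarrow> nat) \<Rightarrow> (nat \<Rightarrow> nat) \<Rightarrow> (nat \<Rightarrow> bool) \<Rightarrow> nat" where
  "defect n a c f = card {i \<in> {1..n}. f (a i) = f i} + card {i \<in> {1..n}. f (c i) \<noteq> f i}"

text \<open>A labelling of the two copies is a pair \<open>X\<close>, \<open>Y\<close> of sets. If \<open>a\<close> almost flips it, both sets almost alternate; if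
\<open>c\<close> almost preserves it, then \<open>t\<close> almost maps \<open>X\<close> to \<open>Y\<close>, because \<open>c\<close> maps the first copy to the second by \<open>t\<close>.\<close>

lemma double_lift_defect:
  fixes M :: nat
  defines "N \<equiv> 192 * M"
  assumes t: "t permutes {..<N}" "t \<notin> bad_perms M"
  shows "M < defect (2 * N) (double_lift N False (shift N)) (double_lift N True t) f"
proof (rule ccontr)
  let ?a = "double_lift N False (shift N)" and ?c = "double_lift N True t"
  define X where "X = {w. w < N \<and> f (Suc w)}"
  define Y where "Y = {w. w < N \<and> f (Suc (w + N))}"
  assume "\<not> M < defect (2 * N) ?a ?c f"
  then have D: "card {i \<in> {1..2 * N}. f (?a i) = f i} \<le> M" "card {i \<in> {1..2 * N}. f (?c i) \<noteq> f i} \<le> M"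
    by (auto simp: defect_def)
  have lt: "shift N w < N" "t w < N" if "w < N" for w
    using permutes_in_image[OF shift_permutes[of N], of w] permutes_in_image[OF t(1), of w] that by auto
  have "card (nonalternating N X) \<le> card {i \<in> {1..2 * N}. f (?a i) = f i}"
    by (rule card_inj_on_le[of Suc]) (auto simp: nonalternating_def X_def double_lift_def lt)
  moreover have "card (nonalternating N Y) \<le> card {i \<in> {1..2 * N}. f (?a i) = f i}"
    by (rule card_inj_on_le[of "\<lambda>w. Suc (w + N)"])
      (auto simp: nonalternating_def Y_def double_lift_def lt inj_on_def)
  moreover have "card {w. w < N \<and> (t w \<in> Y) \<noteq> (w \<in> X)} \<le> card {i \<in> {1..2 * N}. f (?c i) \<noteq> f i}"
    by (rule card_inj_on_le[of Suc]) (auto simp: X_def Y_def double_lift_def lt)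
  ultimately have "t \<in> bad_perms M"
    using t(1) D unfolding bad_perms_def N_def
    by (intro CollectI conjI exI[of _ X] exI[of _ Y]) (auto simp: X_def Y_def N_def)
  then show False using t(2) by simp
qed

text \<open>The labelling \<open>h\<close> and the lower bound for the defect tell \<open>a\<close> and \<open>c\<close> apart. Because the defect is proportional
to \<open>n\<close>, this asymmetry survives amplification and small perturbations.\<close>

definition swap_gap_model ::
    "nat \<Rightarrow> nat \<Rightarrow> (nat \<Rightarrow> nat) \<Rightarrow> (nat \<Rightarrow> nat) \<Rightarrow> (nat \<Rightarrow> bool) \<Rightarrow> bool" where
  "swap_gap_model k n a c h \<longleftrightarrow>
     k < n \<and> a permutes {1..n} \<and> c permutes {1..n} \<and>
     (\<forall>u. reduced u \<and> u \<noteq> [] \<and> length u \<le> k \<longrightarrow> Suc k * card {i \<in> {1..n}. act a c u i = i} \<le> n) \<and>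
     (\<forall>f. n \<le> 384 * defect n a c f) \<and>
     (\<forall>i\<in>{1..n}. h (a i) = h i \<and> h (c i) \<noteq> h i)"

lemma ex_swap_gap_model: "\<exists>n a c h. swap_gap_model k n a c h"
proof -
  obtain M t where M: "M > k" and t: "t permutes {..<192 * M}" "t \<notin> bad_perms M"
    and few: "\<And>u. reduced u \<Longrightarrow> u \<noteq> [] \<Longrightarrow> length u \<le> k \<Longrightarrow>
      Suc k * card {i \<in> {..<192 * M}. act (shift (192 * M)) t u i = i} \<le> 192 * M"
    using ex_balanced_perm[of k] by blast
  define N where "N = 192 * M"
  let ?a = "double_lift N False (shift N)" and ?c = "double_lift N True t"
  let ?h = "\<lambda>i. (i - 1) div N = 0"
  note t = t[folded N_def] and few = few[folded N_def]
  have N: "N > 0" using M by (simp add: N_def)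
  have fixed: "Suc k * card {i \<in> {1..2 * N}. act ?a ?c u i = i} \<le> 2 * N"
    if u: "reduced u" "u \<noteq> []" "length u \<le> k" for u
  proof -
    let ?F = "{i \<in> {..<N}. act (shift N) t u i = i}"
    have "card {i \<in> {1..2 * N}. act ?a ?c u i = i} \<le> card (?F \<times> {..<2::nat})"
    proof (rule card_inj_on_le[of "\<lambda>i. ((i - 1) mod N, (i - 1) div N)"])
      show "inj_on (\<lambda>i. ((i - 1) mod N, (i - 1) div N)) {i \<in> {1..2 * N}. act ?a ?c u i = i}"
        by (rule inj_onI, rule double_coordinates[of _ "2 * N" _ N]) auto
      show "(\<lambda>i. ((i - 1) mod N, (i - 1) div N)) ` {i \<in> {1..2 * N}. act ?a ?c u i = i} \<subseteq> ?F \<times> {..<2}"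
      proof (rule image_subsetI)
        fix i assume "i \<in> {i \<in> {1..2 * N}. act ?a ?c u i = i}"
        then have i: "i \<in> {1..2 * N}" "act ?a ?c u i = i" by auto
        have "act (shift N) t u ((i - 1) mod N) = (i - 1) mod N"
          using act_double_lift[OF shift_permutes t(1) i(1), of False True u] i(2) by simp
        moreover have "(i - 1) div N < 2"
          by (rule double_side[OF i(1)])
        ultimately show "((i - 1) mod N, (i - 1) div N) \<in> ?F \<times> {..<2}" using N by simp
      qed
    qed simp
    then have "Suc k * card {i \<in> {1..2 * N}. act ?a ?c u i = i} \<le> Suc k * (card ?F * 2)"
      by (intro mult_le_mono2) (simp add: card_cartesian_product)
    also have "\<dots> \<le> 2 * N" using few[OF u] by simp
    finally show ?thesis .
  qed
  have side: "?h (?a i) = ?h i \<and> ?h (?c i) \<noteq> ?h i" if i: "i \<in> {1..2 * N}" for i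
  proof -
    have "(i - 1) div N < 2"
      by (rule double_side[OF i])
    then show ?thesis
      by (simp add: double_lift(3)[OF shift_permutes i] double_lift(3)[OF t(1) i] del: One_nat_def) linarith
  qed
  have gap: "2 * N \<le> 384 * defect (2 * N) ?a ?c f" for f
    using double_lift_defect[of t M f] t by (simp add: N_def)
  show ?thesis
  proof (rule exI[of _ "2 * N"], rule exI[of _ ?a], rule exI[of _ ?c], rule exI[of _ ?h],
      unfold swap_gap_model_def, intro conjI)
    show "k < 2 * N" using M by (simp add: N_def)
    show "?a permutes {1..2 * N}" by (rule double_lift_permutes[OF shift_permutes])
    show "?c permutes {1..2 * N}" by (rule double_lift_permutes[OF t(1)])
    show "\<forall>i\<in>{1..2 * N}. ?h (?a i) = ?h i \<and> ?h (?c i) \<noteq> ?h i" by (intro ballI side)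
  qed (use fixed gap in blast)+
qed

section \<open>Amplified models cannot be swapped\<close>

lemma card_blocks:
  assumes "0 < r"
  shows "card {i \<in> {1..n * r}. Q i} = (\<Sum>j<r. card {i \<in> {1..n}. Q (Suc ((i - 1) * r + j))})"
proof -
  have count: "card {i \<in> {1..m}. R i} = (\<Sum>l<m. of_bool (R (Suc l)))" for m and R :: "nat \<Rightarrow> bool"
  proof -
    have "{i \<in> {1..m}. R i} = Suc ` {l \<in> {..<m}. R (Suc l)}"
    proof (intro Set.set_eqI iffI)
      fix i assume "i \<in> {i \<in> {1..m}. R i}"
      then show "i \<in> Suc ` {l \<in> {..<m}. R (Suc l)}" by (cases i) auto
    qed auto
    then have "card {i \<in> {1..m}. R i} = card {l \<in> {..<m}. R (Suc l)}"
      by (simp add: card_image)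
    then show ?thesis by (simp add: of_bool_def sum.If_cases Int_def)
  qed
  have "card {i \<in> {1..n * r}. Q i} = (\<Sum>x<n. \<Sum>l\<in>{x * r..<x * r + r}. of_bool (Q (Suc l)))"
    unfolding count by (rule sum.nat_group[symmetric])
  also have "\<dots> = (\<Sum>x<n. \<Sum>j<r. of_bool (Q (Suc (x * r + j))))"
  proof (rule sum.cong[OF HOL.refl])
    fix x
    show "(\<Sum>l\<in>{x * r..<x * r + r}. of_bool (Q (Suc l)) :: nat) = (\<Sum>j<r. of_bool (Q (Suc (x * r + j))))"
      using sum.atLeastLessThan_shift_0[of "\<lambda>l. of_bool (Q (Suc l)) :: nat" "x * r" "x * r + r"]
      by (simp add: atLeast0LessThan del: sum_of_bool_eq)
  qed
  also have "\<dots> = (\<Sum>j<r. \<Sum>x<n. of_bool (Q (Suc (x * r + j))))"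
    by (rule sum.swap)
  also have "\<dots> = (\<Sum>j<r. card {i \<in> {1..n}. Q (Suc ((i - 1) * r + j))})"
    unfolding count by simp
  finally show ?thesis .
qed

text \<open>A labelling of the amplification consists of \<open>r\<close> labellings of the model, and its defect is the sum of theirs.\<close>

lemma defect_amplify:
  assumes "0 < r" and gap: "\<And>f. n \<le> K * defect n a c f"
  shows "n * r \<le> K * defect (n * r) (amplify_perm r a) (amplify_perm r c) f"
proof -
  define g where "g j i = f (Suc ((i - 1) * r + j))" for i j
  have amp: "f (amplify_perm r p (Suc ((i - 1) * r + j))) = g j (p i)"
    if "i \<in> {1..n}" "j < r" for p i j
    using that assms(1) by (simp add: g_def amplify_perm_Suc)
  have "defect (n * r) (amplify_perm r a) (amplify_perm r c) f = (\<Sum>j<r. defect n a c (g j))"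
    unfolding defect_def card_blocks[OF assms(1)] sum.distrib[symmetric]
  proof (rule sum.cong[OF HOL.refl])
    fix j assume "j \<in> {..<r}"
    then show "card {i \<in> {1..n}. f (amplify_perm r a (Suc ((i - 1) * r + j))) = f (Suc ((i - 1) * r + j))} +
        card {i \<in> {1..n}. f (amplify_perm r c (Suc ((i - 1) * r + j))) \<noteq> f (Suc ((i - 1) * r + j))} =
      card {i \<in> {1..n}. g j (a i) = g j i} + card {i \<in> {1..n}. g j (c i) \<noteq> g j i}"
      using amp by (auto simp: g_def[of j] simp del: atLeastAtMost_iff cong: conj_cong)
  qed
  moreover have "n * r \<le> (\<Sum>j<r. K * defect n a c (g j))"
    using sum_mono[of "{..<r}" "\<lambda>_. n" "\<lambda>j. K * defect n a c (g j)"] gap by (simp add: mult.commute)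
  ultimately show ?thesis by (simp add: sum_distrib_left)
qed

text \<open>If \<open>\<beta>\<close> almost intertwined the pair \<open>A\<close>, \<open>C\<close> with \<open>C\<close>, \<open>A\<close>, then the pullback along \<open>\<beta>\<close> of the amplification of \<open>h\<close> would
be almost flipped by \<open>A\<close> and almost preserved by \<open>C\<close>.\<close>

lemma swap_gap:
  assumes n: "0 < n" and r: "0 < r" and ac: "a permutes {1..n}" "c permutes {1..n}"
    and \<beta>: "\<beta> permutes {1..n * r}"
    and gap: "\<And>f. n \<le> 384 * defect n a c f"
    and h: "\<And>i. i \<in> {1..n} \<Longrightarrow> h (a i) = (h i :: bool)" "\<And>i. i \<in> {1..n} \<Longrightarrow> h (c i) \<noteq> h i"
  defines "A \<equiv> amplify_perm r a" and "C \<equiv> amplify_perm r c"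
  shows "1 / 384 \<le> hamming_dist (n * r) (C \<circ> \<beta>) (\<beta> \<circ> A) + hamming_dist (n * r) (A \<circ> \<beta>) (\<beta> \<circ> C)"
proof -
  define h' where "h' i = h (Suc ((i - 1) div r))" for i
  have base: "Suc ((i - 1) div r) \<in> {1..n}" if "i \<in> {1..n * r}" for i
  proof -
    have "(i - 1) div r < n" using that by (intro less_mult_imp_div_less) auto
    then show ?thesis by simp
  qed
  have amp: "h' (amplify_perm r p i) = h (p (Suc ((i - 1) div r)))"
    if "i \<in> {1..n * r}" "p permutes {1..n}" for p i
    using that(1) r permutes_Suc[OF that(2), of "(i - 1) div r"]
    by (cases i) (simp_all add: h'_def amplify_perm_Suc)
  have h': "h' (A i) = h' i" "h' (C i) \<noteq> h' i" if "i \<in> {1..n * r}" for i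
    using amp[OF that ac(1)] amp[OF that ac(2)] h[OF base[OF that]]
    by (simp_all add: A_def C_def h'_def)
  let ?f = "h' \<circ> \<beta>" and ?I = "{1..n * r}"
  have \<beta>I: "\<beta> i \<in> ?I" if "i \<in> ?I" for i
    using permutes_in_image[OF \<beta>] that by blast
  have "card {i \<in> ?I. ?f (A i) = ?f i} \<le> card {i \<in> ?I. (C \<circ> \<beta>) i \<noteq> (\<beta> \<circ> A) i}"
    using h'(2)[OF \<beta>I] by (intro card_mono) (auto simp del: atLeastAtMost_iff, metis+)
  moreover have "card {i \<in> ?I. ?f (C i) \<noteq> ?f i} \<le> card {i \<in> ?I. (A \<circ> \<beta>) i \<noteq> (\<beta> \<circ> C) i}"
    using h'(1)[OF \<beta>I] by (intro card_mono) (auto simp del: atLeastAtMost_iff, metis+)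
  moreover have "n * r \<le> 384 * defect (n * r) A C ?f"
    unfolding A_def C_def by (rule defect_amplify[OF r gap])
  ultimately have "n * r \<le> 384 * (card {i \<in> ?I. (C \<circ> \<beta>) i \<noteq> (\<beta> \<circ> A) i} + card {i \<in> ?I. (A \<circ> \<beta>) i \<noteq> (\<beta> \<circ> C) i})"
    unfolding defect_def by (meson add_mono mult_le_mono2 order_trans)
  moreover have "real m \<le> 384 * (real x + real y)" if "m \<le> 384 * (x + y)" for m x y :: nat
    using of_nat_mono[OF that, where 'a = real] by simp
  ultimately have "real (n * r) \<le> 384 * (real (card {i \<in> ?I. (C \<circ> \<beta>) i \<noteq> (\<beta> \<circ> A) i})
      + real (card {i \<in> ?I. (A \<circ> \<beta>) i \<noteq> (\<beta> \<circ> C) i}))"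
    by blast
  moreover have "0 < real (n * r)" using n r by simp
  ultimately show ?thesis
    unfolding hamming_dist_def add_divide_distrib[symmetric] by (simp add: pos_le_divide_eq)
qed

section \<open>Representations of the free group in the ultraproduct\<close>

definition ultra_class :: "nat filter \<Rightarrow> (nat \<Rightarrow> nat) \<Rightarrow> (nat \<Rightarrow> nat \<Rightarrow> nat) \<Rightarrow> (nat \<Rightarrow> nat \<Rightarrow> nat) set" where
  "ultra_class \<omega> n p = null_seqs \<omega> n #>\<^bsub>perm_seqs n\<^esub> p"

lemma hamming_dist_eq_ultra_class:
  assumes p: "p \<in> carrier (perm_seqs n)" and q: "q \<in> carrier (perm_seqs n)"
    and eq: "ultra_class \<omega> n p = ultra_class \<omega> n q"
  shows "((\<lambda>k. hamming_dist (n k) (p k) (q k)) \<longlongrightarrow> 0) \<omega>"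
proof -
  have "p \<in> null_seqs \<omega> n #>\<^bsub>perm_seqs n\<^esub> q"
    unfolding eq[unfolded ultra_class_def, symmetric]
    by (rule group.rcos_self[OF perm_seqs_group p normal_imp_subgroup[OF null_seqs_normal]])
  then obtain z where z: "z \<in> null_seqs \<omega> n" "p = (\<lambda>k. z k \<circ> q k)"
    unfolding r_coset_def perm_seqs_mult by blast
  have le: "hamming_dist (n k) (p k) (q k) \<le> hamming_dist (n k) (z k) id" for k
  proof -
    have qk: "q k permutes {1..n k}" using q by (simp add: perm_seqs_carrier del: carrier_product_group)
    have "card {i \<in> {1..n k}. p k i \<noteq> q k i} \<le> card {i \<in> {1..n k}. z k i \<noteq> id i}"
    proof (rule card_inj_on_le[of "q k"])
      show "inj_on (q k) {i \<in> {1..n k}. p k i \<noteq> q k i}"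
        by (rule permutes_inj_on[OF qk])
      show "q k ` {i \<in> {1..n k}. p k i \<noteq> q k i} \<subseteq> {i \<in> {1..n k}. z k i \<noteq> id i}"
        using permutes_in_image[OF qk] unfolding z(2) by (auto simp del: atLeastAtMost_iff)
    qed simp
    then show ?thesis unfolding hamming_dist_def by (intro divide_right_mono) auto
  qed
  show ?thesis
  proof (rule tendsto_sandwich[of "\<lambda>_. 0"])
    show "((\<lambda>k. hamming_dist (n k) (z k) id) \<longlongrightarrow> 0) \<omega>"
      using z(1) by (simp add: null_seqs_def)
  qed (auto simp: hamming_dist_nonneg le)
qed

lemma free_ultrafilter_le_sequentially:
  assumes "free_ultrafilter \<omega>" shows "\<omega> \<le> sequentially"
proof (rule filter_leI)
  fix Q :: "nat \<Rightarrow> bool" assume "eventually Q sequentially"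
  then obtain m where m: "\<And>k. k \<ge> m \<Longrightarrow> Q k" by (auto simp: eventually_sequentially)
  have "{k. \<not> Q k} \<subseteq> {..<m}" using m by (auto simp: not_le[symmetric])
  then have "finite {k. \<not> Q k}" by (rule finite_subset) simp
  then show "eventually Q \<omega>"
    using assms unfolding free_ultrafilter_def by blast
qed

lemma ultraprod_carrier: "carrier (ultraprod \<omega> n) = ultra_class \<omega> n ` carrier (perm_seqs n)"
  unfolding ultraprod_def carrier_FactGroup ultra_class_def by auto

lemma ultra_class_mult:
  assumes "p \<in> carrier (perm_seqs n)" "q \<in> carrier (perm_seqs n)"
  shows "ultra_class \<omega> n p \<otimes>\<^bsub>ultraprod \<omega> n\<^esub> ultra_class \<omega> n q = ultra_class \<omega> n (\<lambda>k. p k \<circ> q k)"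
  unfolding ultraprod_def mult_FactGroup ultra_class_def
    normal.rcos_sum[OF null_seqs_normal assms] perm_seqs_mult ..

lemma F2_mult: "x \<otimes>\<^bsub>F2\<^esub> y = x \<otimes>\<^bsub>Z_free_Z2\<^esub> y"
  by (simp add: F2_def)

lemma F2_one: "\<one>\<^bsub>F2\<^esub> = word_class RB []"
  by (simp add: F2_def Z_free_Z2_def presented_group_one)

lemma fold_word_mult:
  "word_class RB (fold_word u) \<otimes>\<^bsub>Z_free_Z2\<^esub> word_class RB (fold_word v) = word_class RB (fold_word (u @ v))"
  by (simp add: Z_free_Z2_def fold_word_append)

lemma gen_a_fold: "gen_a = word_class RB (fold_word [(Gen_A, False)])"
  by (simp add: gen_a_def)

lemma gen_c_fold: "gen_c = word_class RB (fold_word [(Gen_B, False)])"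
  by (simp add: gen_c_def gen_a_def gen_b_def Z_free_Z2_def)

lemma gens_in_F2: "gen_a \<in> carrier F2" "gen_c \<in> carrier F2"
  using gens_in_Z_free_Z2 by (simp_all add: F2_def carrier_subgroup_generated generate.incl)

lemma F2_words:
  assumes "g \<in> carrier F2"
  obtains u where "g = word_class RB (fold_word u)"
proof -
  interpret G: group Z_free_Z2 by (rule Z_free_Z2_is_group)
  have inv_letter: "inv\<^bsub>Z_free_Z2\<^esub> (word_class RB (fold_word [(x, False)])) = word_class RB (fold_word [(x, True)])" for x
  proof (rule G.inv_equality)
    have "word_cong RB (fold_word ([(x, True)] @ [(x, False)])) (fold_word [])"
      using fold_word_cong[OF word_cong.cancel[of "{}" x True]] by simp
    then show "word_class RB (fold_word [(x, True)]) \<otimes>\<^bsub>Z_free_Z2\<^esub> word_class RB (fold_word [(x, False)]) = \<one>\<^bsub>Z_free_Z2\<^esub>"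
      unfolding fold_word_mult by (simp add: Z_free_Z2_def presented_group_one word_class_eq_iff)
  qed (auto simp: Z_free_Z2_def presented_group_carrier)
  have "g \<in> generate Z_free_Z2 {gen_a, gen_c}"
    using assms gens_in_Z_free_Z2 by (simp add: F2_def carrier_subgroup_generated Int_absorb1)
  then have "\<exists>u. g = word_class RB (fold_word u)"
  proof (induction rule: generate.induct)
    case one
    show ?case by (rule exI[of _ "[]"]) (simp add: Z_free_Z2_def presented_group_one)
  next
    case (incl h)
    then show ?case using gen_a_fold gen_c_fold by blast
  next
    case (inv h)
    then have "h = word_class RB (fold_word [(Gen_A, False)]) \<or> h = word_class RB (fold_word [(Gen_B, False)])"
      using gen_a_fold gen_c_fold by blast
    then show ?case using inv_letter by blast
  next
    case (eng h1 h2)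
    then show ?case using fold_word_mult by metis
  qed
  then show ?thesis using that by blast
qed

text \<open>An element of \<open>F2\<close> is a class of words in \<open>a\<close> and \<open>b\<close>; \<open>unfold_word\<close> rewrites a representative as a word in the free
generators \<open>a\<close> and \<open>c\<close>, where \<open>Gen_B\<close> now stands for \<open>c\<close>.\<close>

definition word_rep :: "nat filter \<Rightarrow> (nat \<Rightarrow> nat) \<Rightarrow> (nat \<Rightarrow> gen \<Rightarrow> nat \<Rightarrow> nat) \<Rightarrow>
    gen word set \<Rightarrow> (nat \<Rightarrow> nat \<Rightarrow> nat) set" where
  "word_rep \<omega> n p =
     (\<lambda>g\<in>carrier F2. ultra_class \<omega> n (\<lambda>k. word_perm (p k) (unfold_word False (SOME u. u \<in> g))))"

context
  fixes \<omega> :: "nat filter" and n :: "nat \<Rightarrow> nat" and p :: "nat \<Rightarrow> gen \<Rightarrow> nat \<Rightarrow> nat"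
  assumes p: "\<And>k x. p k x permutes {1..n k}"
begin

lemma word_seq_carrier: "(\<lambda>k. word_perm (p k) u) \<in> carrier (perm_seqs n)"
  unfolding perm_seqs_carrier using p by (blast intro: word_perm_permutes)

lemma word_rep_fold:
  assumes "word_class RB (fold_word u) \<in> carrier F2"
  shows "word_rep \<omega> n p (word_class RB (fold_word u)) = ultra_class \<omega> n (\<lambda>k. word_perm (p k) u)"
proof -
  let ?v = "SOME v. v \<in> word_class RB (fold_word u)"
  have "word_cong RB (fold_word u) ?v"
    by (metis mem_word_class someI word_cong.refl)
  then have "word_cong {} u (unfold_word False ?v)"
    using unfold_word_cong unfold_fold_word by metis
  then have "word_perm (p k) (unfold_word False ?v) = word_perm (p k) u" for k
    using word_perm_cong[of "p k" u] p permutes_bij by metis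
  then show ?thesis using assms by (simp add: word_rep_def)
qed

lemma word_rep_hom: "word_rep \<omega> n p \<in> hom F2 (ultraprod \<omega> n)"
proof (rule homI)
  interpret F: group F2
    unfolding F2_def by (rule group.group_subgroup_generated[OF Z_free_Z2_is_group])
  fix g h assume g: "g \<in> carrier F2" and h: "h \<in> carrier F2"
  obtain u v where u: "g = word_class RB (fold_word u)" and v: "h = word_class RB (fold_word v)"
    using F2_words[OF g] F2_words[OF h] by metis
  have gh: "g \<otimes>\<^bsub>F2\<^esub> h = word_class RB (fold_word (u @ v))"
    unfolding u v F2_mult by (rule fold_word_mult)
  show "word_rep \<omega> n p g \<in> carrier (ultraprod \<omega> n)"
    using word_rep_fold[of u] g word_seq_carrier[of u] unfolding u ultraprod_carrier by simp
  show "word_rep \<omega> n p (g \<otimes>\<^bsub>F2\<^esub> h) = word_rep \<omega> n p g \<otimes>\<^bsub>ultraprod \<omega> n\<^esub> word_rep \<omega> n p h"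
    using word_rep_fold[of u] word_rep_fold[of v] word_rep_fold[of "u @ v"] g h F.m_closed[OF g h]
      ultra_class_mult[OF word_seq_carrier[of u] word_seq_carrier[of v]]
    by (simp add: gh) (simp add: u v word_perm_append)
qed

lemma word_rep_sofic:
  assumes \<omega>: "free_ultrafilter \<omega>" and n: "\<And>k. k < n k"
    and few: "\<And>k u. reduced u \<Longrightarrow> u \<noteq> [] \<Longrightarrow> length u \<le> k \<Longrightarrow>
      Suc k * card {i \<in> {1..n k}. word_perm (p k) u i = i} \<le> n k"
  shows "(n, word_rep \<omega> n p) \<in> sofic_reps \<omega> F2"
proof -
  have "ultra_trace \<omega> n (word_rep \<omega> n p g) = 0" if g: "g \<in> carrier F2" "g \<noteq> \<one>\<^bsub>F2\<^esub>" for g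
  proof -
    obtain w where w: "g = word_class RB (fold_word w)" using F2_words[OF g(1)] .
    obtain u where u: "reduced u" "word_cong {} w u" using ex_reduced by blast
    have gu: "g = word_class RB (fold_word u)"
      unfolding w word_class_eq_iff by (rule fold_word_cong[OF u(2)])
    then have "u \<noteq> []" using g(2) by (auto simp: F2_one)
    have "perm_trace (n k) (word_perm (p k) u) \<le> inverse (real (Suc k))" if k: "length u \<le> k" for k
    proof -
      have "real (Suc k) * real (card {i \<in> {1..n k}. word_perm (p k) u i = i}) \<le> real (n k)"
        using few[OF u(1) \<open>u \<noteq> []\<close> k] unfolding of_nat_mult[symmetric] by (rule of_nat_mono)
      moreover have "0 < real (n k)" using n[of k] by simp
      moreover have "x / y \<le> inverse z" if "z * x \<le> y" "0 < y" "0 < z" for x y z :: real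
        using that by (simp add: field_simps)
      ultimately show ?thesis
        unfolding perm_trace_def by simp
    qed
    then have le: "\<forall>\<^sub>F k in sequentially. perm_trace (n k) (word_perm (p k) u) \<le> inverse (real (Suc k))"
      unfolding eventually_sequentially by blast
    have "((\<lambda>k. perm_trace (n k) (word_perm (p k) u)) \<longlongrightarrow> 0) sequentially"
    proof (rule tendsto_sandwich[OF _ le tendsto_const LIMSEQ_inverse_real_of_nat])
      show "\<forall>\<^sub>F k in sequentially. 0 \<le> perm_trace (n k) (word_perm (p k) u)"
        by (intro always_eventually allI) (simp add: perm_trace_def)
    qed
    then have "((\<lambda>k. perm_trace (n k) (word_perm (p k) u)) \<longlongrightarrow> 0) \<omega>"
      by (rule filterlim_mono[OF _ order.refl free_ultrafilter_le_sequentially[OF \<omega>]])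
    moreover have "((\<lambda>k. perm_trace (n k) (word_perm (p k) u)) \<longlongrightarrow> ultra_trace \<omega> n (word_rep \<omega> n p g)) \<omega>"
      using ultra_trace_coset[OF \<omega> word_seq_carrier[of u]] word_rep_fold[of u] g(1)
      by (simp only: gu ultra_class_def)
    moreover have "\<omega> \<noteq> bot" using \<omega> by (simp add: free_ultrafilter_def)
    ultimately show ?thesis
      using tendsto_unique by metis
  qed
  moreover have "filterlim n at_top sequentially"
    by (rule filterlim_at_top_mono[OF filterlim_ident always_eventually]) (use n less_imp_le in blast)
  moreover have "0 < n k" for k using n[of k] by simp
  moreover have "word_rep \<omega> n p \<in> extensional (carrier F2)" by (simp add: word_rep_def)
  ultimately show ?thesis
    using word_rep_hom by (simp add: sofic_reps_def)
qed

end

section \<open>The restriction map\<close>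

text \<open>The element \<open>b\<close> is the image of the generator of order two, transported by the conjugating element: \<open>c b = b a\<close> and
\<open>a b = b c\<close> hold in \<open>G\<close>.\<close>

lemma restriction_swaps_gens:
  assumes y: "(n', \<Psi>) \<in> sofic_reps \<omega> Z_free_Z2"
    and eq: "(restrict_rep F2 (n', \<Psi>), (n, \<Theta>)) \<in> sofic_equiv \<omega> F2"
  obtains s b where "\<And>k. 0 < s k" "b \<in> carrier (ultraprod \<omega> (\<lambda>k. n k * s k))"
    "amplify \<omega> n s (\<Theta> gen_c) \<otimes>\<^bsub>ultraprod \<omega> (\<lambda>k. n k * s k)\<^esub> b =
      b \<otimes>\<^bsub>ultraprod \<omega> (\<lambda>k. n k * s k)\<^esub> amplify \<omega> n s (\<Theta> gen_a)"
    "amplify \<omega> n s (\<Theta> gen_a) \<otimes>\<^bsub>ultraprod \<omega> (\<lambda>k. n k * s k)\<^esub> b =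
      b \<otimes>\<^bsub>ultraprod \<omega> (\<lambda>k. n k * s k)\<^esub> amplify \<omega> n s (\<Theta> gen_c)"
proof -
  obtain r s where pos: "\<And>k. 0 < r k" "\<And>k. 0 < s k"
    and c: "conjugate_reps \<omega> F2 (amplify_rep \<omega> F2 r (restrict_rep F2 (n', \<Psi>))) (amplify_rep \<omega> F2 s (n, \<Theta>))"
    using eq unfolding sofic_equiv_def by blast
  let ?U = "ultraprod \<omega> (\<lambda>k. n k * s k)"
  have m: "(\<lambda>k. n' k * r k) = (\<lambda>k. n k * s k)"
    using c by (simp add: conjugate_reps_def amplify_rep_def restrict_rep_def)
  interpret U: group ?U by (rule ultraprod_group)
  obtain v where v: "v \<in> carrier ?U"
    and conj: "\<And>g. g \<in> carrier F2 \<Longrightarrow>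
      amplify \<omega> n s (\<Theta> g) = v \<otimes>\<^bsub>?U\<^esub> amplify \<omega> n' r (\<Psi> g) \<otimes>\<^bsub>?U\<^esub> inv\<^bsub>?U\<^esub> v"
    using c by (auto simp: conjugate_reps_def amplify_rep_def restrict_rep_def m)
  interpret G: group Z_free_Z2 by (rule Z_free_Z2_is_group)
  have \<Psi>: "\<Psi> \<in> hom Z_free_Z2 (ultraprod \<omega> n')" using y by (simp add: sofic_reps_def)
  have amp: "amplify \<omega> n' r \<in> hom (ultraprod \<omega> n') ?U"
    using amplify_hom[of r \<omega> n', OF pos(1)] by (simp only: m)
  define \<phi> where "\<phi> g = v \<otimes>\<^bsub>?U\<^esub> amplify \<omega> n' r (\<Psi> g) \<otimes>\<^bsub>?U\<^esub> inv\<^bsub>?U\<^esub> v" for g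
  have X: "amplify \<omega> n' r (\<Psi> g) \<in> carrier ?U" if "g \<in> carrier Z_free_Z2" for g
    using that \<Psi> amp by (blast intro: hom_in_carrier)
  have \<phi>_mult: "\<phi> (g \<otimes>\<^bsub>Z_free_Z2\<^esub> h) = \<phi> g \<otimes>\<^bsub>?U\<^esub> \<phi> h"
    if "g \<in> carrier Z_free_Z2" "h \<in> carrier Z_free_Z2" for g h
  proof -
    have cancel: "inv\<^bsub>?U\<^esub> v \<otimes>\<^bsub>?U\<^esub> (v \<otimes>\<^bsub>?U\<^esub> x) = x" if "x \<in> carrier ?U" for x
      using that v by (simp add: U.m_assoc[symmetric])
    have "amplify \<omega> n' r (\<Psi> (g \<otimes>\<^bsub>Z_free_Z2\<^esub> h)) = amplify \<omega> n' r (\<Psi> g) \<otimes>\<^bsub>?U\<^esub> amplify \<omega> n' r (\<Psi> h)"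
      using that \<Psi> amp by (simp add: hom_mult hom_in_carrier)
    then show ?thesis
      using that X v by (simp add: \<phi>_def U.m_assoc cancel)
  qed
  note gens = gens_in_Z_free_Z2
  have bb: "gen_b \<otimes>\<^bsub>Z_free_Z2\<^esub> gen_b = \<one>\<^bsub>Z_free_Z2\<^esub>"
    using word_cong.relator[of "[(Gen_B, False), (Gen_B, False)]" RB]
    by (simp add: gen_b_def Z_free_Z2_def presented_group_one word_class_eq_iff)
  have cb: "gen_c \<otimes>\<^bsub>Z_free_Z2\<^esub> gen_b = gen_b \<otimes>\<^bsub>Z_free_Z2\<^esub> gen_a"
    using gens bb by (simp add: gen_c_def G.m_assoc)
  have ab: "gen_a \<otimes>\<^bsub>Z_free_Z2\<^esub> gen_b = gen_b \<otimes>\<^bsub>Z_free_Z2\<^esub> gen_c"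
    using gens bb by (simp add: gen_c_def G.m_assoc[symmetric])
  show thesis
  proof (rule that[OF pos(2)])
    show "\<phi> gen_b \<in> carrier ?U"
      using X[OF gens(2)] v by (simp add: \<phi>_def)
    show "amplify \<omega> n s (\<Theta> gen_c) \<otimes>\<^bsub>?U\<^esub> \<phi> gen_b = \<phi> gen_b \<otimes>\<^bsub>?U\<^esub> amplify \<omega> n s (\<Theta> gen_a)"
      unfolding conj[OF gens_in_F2(1)] conj[OF gens_in_F2(2)] \<phi>_def[symmetric]
      using \<phi>_mult gens cb by metis
    show "amplify \<omega> n s (\<Theta> gen_a) \<otimes>\<^bsub>?U\<^esub> \<phi> gen_b = \<phi> gen_b \<otimes>\<^bsub>?U\<^esub> amplify \<omega> n s (\<Theta> gen_c)"
      unfolding conj[OF gens_in_F2(1)] conj[OF gens_in_F2(2)] \<phi>_def[symmetric]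
      using \<phi>_mult gens ab by metis
  qed
qed

theorem mainTheorem1:
  fixes \<omega> :: "nat filter"
  assumes "free_ultrafilter \<omega>"
  shows "restriction_map \<omega> F2 ` Sof \<omega> Z_free_Z2 \<noteq> Sof \<omega> F2"
proof
  assume surj: "restriction_map \<omega> F2 ` Sof \<omega> Z_free_Z2 = Sof \<omega> F2"
  have \<omega>0: "\<omega> \<noteq> bot" using assms by (simp add: free_ultrafilter_def)
  obtain n a c h where model: "\<And>k. swap_gap_model k (n k) (a k) (c k) (h k)"
    using ex_swap_gap_model by metis
  then have n: "\<And>k. k < n k"
    and perm: "\<And>k. a k permutes {1..n k}" "\<And>k. c k permutes {1..n k}"
    and few: "\<And>k u. reduced u \<Longrightarrow> u \<noteq> [] \<Longrightarrow> length u \<le> k \<Longrightarrow>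
      Suc k * card {i \<in> {1..n k}. act (a k) (c k) u i = i} \<le> n k"
    and gap: "\<And>k f. n k \<le> 384 * defect (n k) (a k) (c k) f"
    and h: "\<And>k i. i \<in> {1..n k} \<Longrightarrow> h k (a k i) = h k i"
      "\<And>k i. i \<in> {1..n k} \<Longrightarrow> h k (c k i) \<noteq> h k i"
    unfolding swap_gap_model_def by blast+
  define p where "p k = case_gen (a k) (c k)" for k
  have p: "p k x permutes {1..n k}" for k x
    using perm by (cases x) (simp_all add: p_def)
  have x: "(n, word_rep \<omega> n p) \<in> sofic_reps \<omega> F2"
    by (rule word_rep_sofic[OF p assms n]) (use few in \<open>simp_all add: p_def\<close>)
  let ?x = "(n, word_rep \<omega> n p)"
  have "sofic_equiv \<omega> F2 `` {?x} \<in> Sof \<omega> F2"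
    unfolding Sof_def using x by (rule quotientI)
  then obtain Y where "Y \<in> Sof \<omega> Z_free_Z2" and Y: "sofic_equiv \<omega> F2 `` {?x} = restriction_map \<omega> F2 Y"
    using surj by blast
  then obtain y where y: "y \<in> sofic_reps \<omega> Z_free_Z2" "Y = sofic_equiv \<omega> Z_free_Z2 `` {y}"
    unfolding Sof_def by (blast elim: quotientE)
  have "sofic_equiv \<omega> F2 `` {restrict_rep F2 y} = sofic_equiv \<omega> F2 `` {?x}"
    using Y restriction_map_class[OF Z_free_Z2_is_group F2_def y(1)] y(2) by simp
  then have equiv: "(restrict_rep F2 y, ?x) \<in> sofic_equiv \<omega> F2"
    using eq_equiv_class[OF _ equiv_sofic_equiv x] by blast
  obtain n' \<Psi> where y': "y = (n', \<Psi>)" by force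
  obtain s b where s: "\<And>k. 0 < s k" and b: "b \<in> carrier (ultraprod \<omega> (\<lambda>k. n k * s k))"
    and swap: "amplify \<omega> n s (word_rep \<omega> n p gen_c) \<otimes>\<^bsub>ultraprod \<omega> (\<lambda>k. n k * s k)\<^esub> b =
        b \<otimes>\<^bsub>ultraprod \<omega> (\<lambda>k. n k * s k)\<^esub> amplify \<omega> n s (word_rep \<omega> n p gen_a)"
      "amplify \<omega> n s (word_rep \<omega> n p gen_a) \<otimes>\<^bsub>ultraprod \<omega> (\<lambda>k. n k * s k)\<^esub> b =
        b \<otimes>\<^bsub>ultraprod \<omega> (\<lambda>k. n k * s k)\<^esub> amplify \<omega> n s (word_rep \<omega> n p gen_c)"
    using restriction_swaps_gens[OF y(1)[unfolded y'] equiv[unfolded y']] by blast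
  let ?m = "\<lambda>k. n k * s k"
  define A C where "A k = amplify_perm (s k) (a k)" and "C k = amplify_perm (s k) (c k)" for k
  obtain \<beta> where \<beta>: "\<beta> \<in> carrier (perm_seqs ?m)" "b = ultra_class \<omega> ?m \<beta>"
    using b unfolding ultraprod_carrier by blast
  have ac: "a \<in> carrier (perm_seqs n)" "c \<in> carrier (perm_seqs n)"
    using perm unfolding perm_seqs_carrier by auto
  have AC: "A \<in> carrier (perm_seqs ?m)" "C \<in> carrier (perm_seqs ?m)"
    using amplify_seq_carrier[OF s ac(1)] amplify_seq_carrier[OF s ac(2)] unfolding A_def C_def by auto
  have rep: "word_rep \<omega> n p (word_class RB (fold_word u)) = ultra_class \<omega> n (\<lambda>k. word_perm (p k) u)"
    if "word_class RB (fold_word u) \<in> carrier F2" for u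
    by (rule word_rep_fold[where p = p and n = n, OF p that])
  have "word_rep \<omega> n p gen_a = ultra_class \<omega> n a" "word_rep \<omega> n p gen_c = ultra_class \<omega> n c"
    using rep[OF gens_in_F2(1)[unfolded gen_a_fold]] rep[OF gens_in_F2(2)[unfolded gen_c_fold]]
    unfolding gen_a_fold gen_c_fold by (simp_all add: p_def)
  then have ampl: "amplify \<omega> n s (word_rep \<omega> n p gen_a) = ultra_class \<omega> ?m A"
      "amplify \<omega> n s (word_rep \<omega> n p gen_c) = ultra_class \<omega> ?m C"
    using amplify_coset[OF s ac(1), of \<omega>] amplify_coset[OF s ac(2), of \<omega>]
    unfolding ultra_class_def A_def C_def by simp_all
  have closed: "(\<lambda>k. p k \<circ> q k) \<in> carrier (perm_seqs ?m)"
    if "p \<in> carrier (perm_seqs ?m)" "q \<in> carrier (perm_seqs ?m)" for p q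
    using that unfolding perm_seqs_carrier by (blast intro: permutes_compose)
  have "((\<lambda>k. hamming_dist (?m k) (C k \<circ> \<beta> k) (\<beta> k \<circ> A k)) \<longlongrightarrow> 0) \<omega>"
    using swap(1) unfolding ampl \<beta>(2) ultra_class_mult[OF AC(2) \<beta>(1)] ultra_class_mult[OF \<beta>(1) AC(1)]
    by (rule hamming_dist_eq_ultra_class[OF closed[OF AC(2) \<beta>(1)] closed[OF \<beta>(1) AC(1)]])
  moreover have "((\<lambda>k. hamming_dist (?m k) (A k \<circ> \<beta> k) (\<beta> k \<circ> C k)) \<longlongrightarrow> 0) \<omega>"
    using swap(2) unfolding ampl \<beta>(2) ultra_class_mult[OF AC(1) \<beta>(1)] ultra_class_mult[OF \<beta>(1) AC(2)]
    by (rule hamming_dist_eq_ultra_class[OF closed[OF AC(1) \<beta>(1)] closed[OF \<beta>(1) AC(2)]])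
  ultimately have "((\<lambda>k. hamming_dist (?m k) (C k \<circ> \<beta> k) (\<beta> k \<circ> A k) +
      hamming_dist (?m k) (A k \<circ> \<beta> k) (\<beta> k \<circ> C k)) \<longlongrightarrow> 0) \<omega>"
    by (rule tendsto_add_zero)
  moreover
  have "1 / 384 \<le> hamming_dist (?m k) (C k \<circ> \<beta> k) (\<beta> k \<circ> A k) +
      hamming_dist (?m k) (A k \<circ> \<beta> k) (\<beta> k \<circ> C k)" for k
  proof -
    have "0 < n k" using n[of k] by simp
    moreover have "\<beta> k permutes {1..?m k}" using \<beta>(1) unfolding perm_seqs_carrier by blast
    ultimately show ?thesis
      unfolding A_def C_def
      by (intro swap_gap[where a = "a k" and c = "c k" and h = "h k"] s perm gap h)
  qed
  then have "\<forall>\<^sub>F k in \<omega>. 1 / 384 \<le> hamming_dist (?m k) (C k \<circ> \<beta> k) (\<beta> k \<circ> A k) +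
      hamming_dist (?m k) (A k \<circ> \<beta> k) (\<beta> k \<circ> C k)"
    by (intro always_eventually allI)
  ultimately have "(1 / 384 :: real) \<le> 0"
    using tendsto_lowerbound[OF _ _ \<omega>0] by blast
  then show False by simp
qed

end
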